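(* For all real numbers $x \geq 1$, define $$\mathcal{D}(x) := \sum_{n \leq x}\sigma(n) - \frac{x^2 \zeta(2)}{2}, \qquad d(x) := \sum_{n \leq x} \frac{\sigma(n)}{n} - \left( x\,\zeta(2) - \tfrac{1}{2} \log x \right).$$ Then, for all real $x \geq 650$, $$\mathcal{D}(x) - x\,d(x) = \frac{x}{2} \left( \log 2\pi + \gamma - 1 \right) + O^{\star}\!\left( 16\, x^{3/10} \log x \right).$$
   Context: $\sigma(n) = \sum_{d \mid n} d$ is the sum-of-divisors function, $\zeta$ is the Riemann zeta function, $\gamma$ is Euler's constant, and $\log$ is the natural logarithm; sums $\sum_{n\le x}$ run over positive integers $n \le x$. The notation $F = G + O^{\star}(H)$ means $|F - G| \leq H$. *)

theory Defs
  imports "HOL-Analysis.Analysis"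
begin

definition sigma :: "nat \<Rightarrow> nat" where
  "sigma n = (\<Sum>d | d dvd n. d)"

text \<open>The Riemann zeta function on its half-line of convergence \<open>s > 1\<close>, as the series
  \<open>1 / 1^s + 1 / 2^s + \<dots>\<close>; for \<open>s \<le> 1\<close> the series diverges and the value is meaningless
  (no continuation is built in).\<close>
definition zeta :: "real \<Rightarrow> real" where
  "zeta s = (\<Sum>n. 1 / real (Suc n) powr s)"

definition D_err :: "real \<Rightarrow> real" where
  "D_err x = (\<Sum>n | 1 \<le> n \<and> real n \<le> x. real (sigma n)) - x ^ 2 * zeta 2 / 2"

definition d_err :: "real \<Rightarrow> real" where
  "d_err x = (\<Sum>n | 1 \<le> n \<and> real n \<le> x. real (sigma n) / real n) - (x * zeta 2 - 1 / 2 * ln x)"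

end

theory Submission
  imports Defs
begin

text \<open>
  Since \<open>\<D>(x) - x d(x) = x\<^sup>2 \<zeta>(2) / 2 - x / 2 log x - I\<close> with \<open>I = \<Sum>\<^bsub>dm \<le> x\<^esub> (x/d - m)\<close>, it
  suffices to evaluate \<open>I\<close>. The hyperbola method with \<open>A = \<lfloor>\<surd>x\<rfloor>\<close> and the Euler--Maclaurin expansions of
  \<open>\<Sum>1/k\<^sup>2\<close>, \<open>\<Sum>1/k\<close> and \<open>\<Sum>log k\<close> give the main term up to \<open>O(1)\<close>, and leave the sums over \<open>m \<le> A\<close> of
  \<open>B\<^sub>2({x/m})\<close>, once plain and once with weights \<open>m\<^sup>2/x\<close>. Partial summation reduces the second to the first.
  Expanding \<open>B\<^sub>2\<close> into its absolutely convergent Fourier series turns these into exponential sums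
  \<open>\<Sum>e(kx/m)\<close> over dyadic blocks \<open>m \<sim> D\<close>. Van der Corput's second derivative test bounds such a sum by
  \<open>(kx/D)\<^sup>1\<^sup>/\<^sup>2\<close>, the third derivative test by \<open>D\<^sup>1\<^sup>/\<^sup>3 (kx)\<^sup>1\<^sup>/\<^sup>6\<close>; the two balance at \<open>D = x\<^sup>2\<^sup>/\<^sup>5\<close>, which is
  where the exponent \<open>3/10\<close> comes from. The number of dyadic blocks produces the logarithm.
\<close>

section \<open>Exponential sums and the Kusmin--Landau inequality\<close>

text \<open>Why \<open>bern2\<close> appears rather than the sawtooth: in \<D>(x) - x d(x) each pair
  (d, m) with dm \<le> x carries the weight x/d - m, which vanishes on the hyperbola dm = x. The
  terms linear in the fractional part therefore drop out in both halves of the hyperbola method, and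
  the first oscillating terms are quadratic. The Fourier coefficients of \<open>bern2\<close> decay
  like 1/k^2, while both derivative tests grow at most like the square root of k; as the sum of
  k^(-3/2) converges, all frequencies are used at once, with no truncation and no smoothing.
  Splitting at the square root of x keeps D^2 \<le> x for every block starting at D. This makes the
  secondary term of the second derivative test harmless, and with D^5 \<le> x^2 also that of the
  third. The non-oscillating part only has to be known up to O(1). The three Euler--Maclaurin
  expansions are carried exactly that far: their errors A^(-4), A^(-3), A^(-2) get multiplied by
  x^2, xA and x, where x is about A^2.\<close>

definition expi :: "real \<Rightarrow> complex" where "expi t = cis (2 * pi * t)"

lemma norm_expi [simp]: "norm (expi t) = 1"
  by (simp add: expi_def)

lemma expi_add: "expi (s + t) = expi s * expi t"
  by (simp add: expi_def cis_mult distrib_left)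

lemma cnj_expi: "cnj (expi t) = expi (- t)"
  by (simp add: expi_def cis_cnj)

lemma expi_of_int [simp]: "expi (of_int n) = 1"
  by (simp add: expi_def cis_multiple_2pi)

lemma norm_sum_expi_le_card: "norm (\<Sum>n\<in>I. expi (f n)) \<le> real (card I)"
  using norm_sum[of "\<lambda>n. expi (f n)" I] by simp

lemma sum_cnj_expi: "norm (\<Sum>n\<in>I. expi (- f n)) = norm (\<Sum>n\<in>I. expi (f n))"
proof -
  have "(\<Sum>n\<in>I. expi (- f n)) = cnj (\<Sum>n\<in>I. expi (f n))"
    by (simp add: cnj_expi)
  then show ?thesis by (simp only: complex_mod_cnj)
qed

text \<open>The real part of 1 / (1 - e(t)) is constant, so differences of two such values are
  purely imaginary and are governed by the cotangent alone.\<close>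

lemma one_minus_expi_inverse:
  assumes "sin (pi * t) \<noteq> 0"
  shows "1 = Complex (1/2) (cot (pi * t) / 2) * (1 - expi t)"
proof -
  have c: "cos (2 * pi * t) = 1 - 2 * sin (pi * t) ^ 2"
    using cos_double_sin[of "pi * t"] by (simp add: mult.assoc)
  have s: "sin (2 * pi * t) = 2 * sin (pi * t) * cos (pi * t)"
    using sin_double[of "pi * t"] by (simp add: mult.assoc)
  have q: "cos (pi * t) ^ 2 = 1 - sin (pi * t) ^ 2"
    by (rule cos_squared_eq)
  have e: "expi t = Complex (1 - 2 * sin (pi * t) ^ 2) (2 * sin (pi * t) * cos (pi * t))"
    by (simp add: expi_def complex_eq_iff c s)
  show ?thesis
    using assms q by (simp add: e complex_eq_iff cot_def power2_eq_square)
qed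

text \<open>Jordan's inequality: sine is concave, so it lies above its chord from 0 to pi/2.\<close>

lemma sin_ge_linear:
  assumes "0 \<le> t" "t \<le> 1/2"
  shows "sin (pi * t) \<ge> 2 * t"
proof -
  have "convex_on {0..pi} (\<lambda>x. - sin x)"
  proof (rule f''_ge0_imp_convex[where f' = "\<lambda>x. - cos x" and f'' = sin])
    show "sin x \<ge> 0" if "x \<in> {0..pi}" for x using that by (auto intro: sin_ge_zero)
  qed (auto intro!: derivative_eq_intros)
  then have "- sin ((1 - 2 * t) *\<^sub>R 0 + (2 * t) *\<^sub>R (pi/2)) \<le> (1 - 2*t) * (- sin 0) + (2*t) * (- sin (pi/2))"
    using assms by (intro convex_onD) auto
  then show ?thesis by (simp add: mult.commute)
qed

lemma sin_ge_endpoint: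
  assumes "0 < \<theta>" "\<theta> \<le> t" "t \<le> 1 - \<theta>"
  shows "sin (pi * t) \<ge> 2 * \<theta>"
proof (cases "t \<le> 1/2")
  case True
  then show ?thesis using sin_ge_linear[of t] assms by auto
next
  case False
  have "sin (pi * t) = sin (pi * (1 - t))" by (simp add: algebra_simps)
  then show ?thesis using sin_ge_linear[of "1 - t"] assms False by auto
qed

text \<open>The difference cot(pi s) - cot(pi t) is sin(pi (t - s)) divided by the positive product
  sin(pi s) sin(pi t).\<close>

lemma cot_antimono:
  assumes "0 < s" "s \<le> t" "t < 1"
  shows "cot (pi * t) \<le> cot (pi * s)"
proof -
  have s: "sin (pi * s) > 0" "sin (pi * t) > 0"
    using assms by (auto intro!: sin_gt_zero)
  have "pi * (t - s) < pi * 1" using assms by (intro mult_strict_left_mono) auto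
  then have "sin (pi * t - pi * s) \<ge> 0"
    using assms by (intro sin_ge_zero) (auto simp: algebra_simps)
  then show ?thesis using s by (simp add: sin_diff cot_def field_simps)
qed

lemma sum_abel_diff:
  fixes c w :: "nat \<Rightarrow> 'a :: comm_ring_1"
  shows "(\<Sum>n\<le>N. c n * (w n - w (Suc n)))
    = c 0 * w 0 + (\<Sum>n<N. (c (Suc n) - c n) * w (Suc n)) - c N * w (Suc N)"
  by (induction N) (auto simp: algebra_simps)

text \<open>With \<open>c\<^sub>n = 1 / (1 - e(\<delta>\<^sub>n)) = (1 + i cot(\<pi> \<delta>\<^sub>n)) / 2\<close> one has \<open>e(f(n)) = c\<^sub>n (e(f(n)) - e(f(n+1)))\<close>, and after
  summation by parts the total variation of \<open>c\<^sub>n\<close> telescopes because the cotangent is monotone.\<close>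
lemma kusmin_landau_atMost:
  fixes f :: "nat \<Rightarrow> real"
  assumes "0 < \<theta>"
    and range: "\<And>n. n \<le> N \<Longrightarrow> \<theta> \<le> f (Suc n) - f n \<and> f (Suc n) - f n \<le> 1 - \<theta>"
    and mono: "\<And>n. n < N \<Longrightarrow> f (Suc n) - f n \<le> f (Suc (Suc n)) - f (Suc n)"
  shows "norm (\<Sum>n\<le>N. expi (f n)) \<le> 1 / \<theta>"
proof -
  define \<delta> where "\<delta> n = f (Suc n) - f n" for n
  define q where "q n = cot (pi * \<delta> n) / 2" for n
  define c where "c n = Complex (1/2) (q n)" for n
  have \<delta>: "0 < \<delta> n" "\<delta> n < 1" "\<theta> \<le> \<delta> n" "\<delta> n \<le> 1 - \<theta>" if "n \<le> N" for n
    using range[OF that] assms(1) by (auto simp: \<delta>_def)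
  have s: "sin (pi * \<delta> n) \<ge> 2 * \<theta>" if "n \<le> N" for n
    using sin_ge_endpoint \<delta>[OF that] assms(1) by blast
  have step: "expi (f n) = c n * (expi (f n) - expi (f (Suc n)))" if "n \<le> N" for n
  proof -
    have "expi (f (Suc n)) = expi (f n) * expi (\<delta> n)"
      by (simp add: \<delta>_def flip: expi_add)
    then have "c n * (expi (f n) - expi (f (Suc n))) = expi (f n) * (c n * (1 - expi (\<delta> n)))"
      by (simp add: algebra_simps)
    also have "c n * (1 - expi (\<delta> n)) = 1"
      using one_minus_expi_inverse[of "\<delta> n"] s[OF that] assms(1) by (simp add: c_def q_def)
    finally show ?thesis by simp
  qed
  have cs: "cmod (c n) = 1 / (2 * sin (pi * \<delta> n))" if "n \<le> N" for n
  proof -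
    have pos: "sin (pi * \<delta> n) > 0" using s[OF that] assms(1) by simp
    have "(cmod (c n))\<^sup>2 = (1/2)\<^sup>2 + (cot (pi * \<delta> n) / 2)\<^sup>2"
      by (simp add: c_def q_def cmod_power2)
    also have "\<dots> = (sin (pi * \<delta> n) ^ 2 + cos (pi * \<delta> n) ^ 2) / (2 * sin (pi * \<delta> n))\<^sup>2"
      using pos by (simp add: cot_def power_divide power_mult_distrib field_simps del: sin_cos_squared_add)
    also have "\<dots> = (1 / (2 * sin (pi * \<delta> n)))\<^sup>2"
      by (simp add: power_divide)
    finally show ?thesis using pos by (simp add: power2_eq_iff_nonneg)
  qed
  have cn: "cmod (c n) \<le> 1 / (4 * \<theta>)" if "n \<le> N" for n
    unfolding cs[OF that] using s[OF that] assms(1) by (intro divide_left_mono) auto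
  have cq: "\<bar>q n\<bar> \<le> 1 / (4 * \<theta>)" if "n \<le> N" for n
    using abs_Im_le_cmod[of "c n"] cn[OF that] by (simp add: c_def)
  have qm: "q (Suc n) \<le> q n" if "n < N" for n
    using cot_antimono[of "\<delta> n" "\<delta> (Suc n)"] \<delta>[of n] \<delta>[of "Suc n"] mono[OF that] that
    by (auto simp: q_def \<delta>_def)
  have "(\<Sum>n\<le>N. expi (f n)) = (\<Sum>n\<le>N. c n * (expi (f n) - expi (f (Suc n))))"
    using step by (intro sum.cong) auto
  also have "\<dots> = c 0 * expi (f 0) + (\<Sum>n<N. (c (Suc n) - c n) * expi (f (Suc n))) - c N * expi (f (Suc N))"
    by (rule sum_abel_diff)
  also have "norm \<dots> \<le> norm (c 0 * expi (f 0)) + norm (\<Sum>n<N. (c (Suc n) - c n) * expi (f (Suc n)))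
      + norm (c N * expi (f (Suc N)))"
    by (meson norm_triangle_ineq norm_triangle_ineq4 add_right_mono order_trans)
  also have "norm (\<Sum>n<N. (c (Suc n) - c n) * expi (f (Suc n))) \<le> (\<Sum>n<N. q n - q (Suc n))"
  proof (rule sum_norm_le)
    fix n assume "n \<in> {..<N}"
    have "norm (c (Suc n) - c n) = \<bar>q (Suc n) - q n\<bar>"
      by (simp add: c_def cmod_def)
    then show "norm ((c (Suc n) - c n) * expi (f (Suc n))) \<le> q n - q (Suc n)"
      using qm[of n] \<open>n \<in> {..<N}\<close> by (simp add: norm_mult)
  qed
  also have "(\<Sum>n<N. q n - q (Suc n)) = q 0 - q N"
    by (rule sum_lessThan_telescope')
  \<comment> \<open>Four contributions of at most 1/(4\<theta>): the two boundary terms, and the two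
    ends of the telescoped variation.\<close>
  also have "norm (c 0 * expi (f 0)) + (q 0 - q N) + norm (c N * expi (f (Suc N)))
      \<le> 1 / (4 * \<theta>) + (1 / (4 * \<theta>) + 1 / (4 * \<theta>)) + 1 / (4 * \<theta>)"
    using cn[of 0] cn[of N] cq[of 0] cq[of N] by (simp add: norm_mult abs_le_iff)
  also have "\<dots> = 1 / \<theta>" by simp
  finally show ?thesis by simp
qed

text \<open>Subtracting n\<nu> from f(n) leaves e(f(n)) unchanged and moves the differences into
  [\<theta>, 1 - \<theta>]. The index set is an interval in disguise (\<open>conv\<close>); it is
  kept as a set because it will be cut out by a condition on the differences.\<close>

lemma kusmin_landau_set:
  fixes f :: "nat \<Rightarrow> real"
  assumes "0 < \<theta>" "finite I"
    and conv: "\<And>i j k. i \<in> I \<Longrightarrow> k \<in> I \<Longrightarrow> i \<le> j \<Longrightarrow> j \<le> k \<Longrightarrow> j \<in> I"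
    and range: "\<And>n. n \<in> I \<Longrightarrow> of_int \<nu> + \<theta> \<le> f (Suc n) - f n \<and> f (Suc n) - f n \<le> of_int \<nu> + 1 - \<theta>"
    and mono: "\<And>n. n \<in> I \<Longrightarrow> Suc n \<in> I \<Longrightarrow> f (Suc n) - f n \<le> f (Suc (Suc n)) - f (Suc n)"
  shows "norm (\<Sum>n\<in>I. expi (f n)) \<le> 1 / \<theta>"
proof (cases "I = {}")
  case True
  then show ?thesis using assms(1) by simp
next
  case False
  define a where "a = Min I"
  define N where "N = Max I - a"
  have ab: "a \<in> I" "Max I \<in> I"
    using False assms(2) by (simp_all add: a_def)
  have bnd: "a \<le> n" "n \<le> Max I" if "n \<in> I" for n
    using that assms(2) by (simp_all add: a_def)
  have aN: "a + N = Max I" using bnd(1)[OF ab(2)] by (simp add: N_def)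
  have I: "n \<in> I \<longleftrightarrow> a \<le> n \<and> n \<le> a + N" for n
    unfolding aN using conv[OF ab, of n] bnd[of n] by blast
  define g where "g n = f (a + n) - real n * of_int \<nu>" for n
  have e: "expi (f (a + n)) = expi (g n)" for n
  proof -
    have "f (a + n) = g n + of_int (int n * \<nu>)" by (simp add: g_def)
    then show ?thesis by (simp only: expi_add expi_of_int mult_1_right)
  qed
  have "norm (\<Sum>n\<le>N. expi (g n)) \<le> 1 / \<theta>"
  proof (rule kusmin_landau_atMost[OF assms(1)])
    show "\<theta> \<le> g (Suc n) - g n \<and> g (Suc n) - g n \<le> 1 - \<theta>" if "n \<le> N" for n
    proof -
      have "a + n \<in> I" using that by (simp add: I)
      from range[OF this] show ?thesis by (simp add: g_def algebra_simps)
    qed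
    show "g (Suc n) - g n \<le> g (Suc (Suc n)) - g (Suc n)" if "n < N" for n
    proof -
      have "a + n \<in> I" "Suc (a + n) \<in> I" using that by (simp_all add: I)
      from mono[OF this] show ?thesis by (simp add: g_def algebra_simps)
    qed
  qed
  also have "(\<Sum>n\<le>N. expi (g n)) = (\<Sum>n\<in>I. expi (f n))"
    by (rule sum.reindex_bij_witness[where i = "\<lambda>n. n - a" and j = "\<lambda>n. a + n"]) (auto simp: I e)
  finally show ?thesis .
qed

text \<open>Counts the indices whose first difference is too close to an integer for Kusmin--Landau.
  The first and the last of them are at most \<theta>/\<rho> apart.\<close>

lemma card_spaced_le:
  fixes \<delta> :: "nat \<Rightarrow> real"
  assumes "\<rho> > 0" "\<theta> \<ge> 0" and I: "I \<subseteq> {..<N}"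
    and sp: "\<And>i j. i \<le> j \<Longrightarrow> j < N \<Longrightarrow> real (j - i) * \<rho> \<le> \<delta> j - \<delta> i"
    and range: "\<And>n. n \<in> I \<Longrightarrow> c \<le> \<delta> n \<and> \<delta> n \<le> c + \<theta>"
  shows "real (card I) \<le> \<theta> / \<rho> + 1"
proof (cases "I = {}")
  case True
  then show ?thesis using assms(1,2) by simp
next
  case False
  have fin: "finite I" using I finite_subset by blast
  define a b where "a = Min I" and "b = Max I"
  have ab: "a \<in> I" "b \<in> I" "a \<le> b" "I \<subseteq> {a..b}"
    using False fin by (auto simp: a_def b_def)
  have "card I \<le> card {a..b}" using ab by (intro card_mono) auto
  then have "real (card I) \<le> real (b - a) + 1" using ab(3) by simp
  moreover have "real (b - a) * \<rho> \<le> \<theta>"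
    using sp[of a b] range[of a] range[of b] ab I by auto
  then have "real (b - a) \<le> \<theta> / \<rho>" using assms(1) by (simp add: field_simps)
  ultimately show ?thesis by simp
qed

section \<open>The second derivative test\<close>

text \<open>The indices are grouped by the integer part of the first difference \<open>\<delta>\<^sub>n\<close>. In each group the trivial bound is
  used where \<open>\<delta>\<^sub>n\<close> is within \<open>\<surd>\<rho>\<close> of an integer, and Kusmin--Landau elsewhere.\<close>
lemma expi_sum_second_difference:
  fixes f :: "nat \<Rightarrow> real"
  assumes "\<rho> > 0" "\<alpha> \<ge> 1"
    and lo: "\<And>n. Suc n < N \<Longrightarrow> \<rho> \<le> (f (Suc (Suc n)) - f (Suc n)) - (f (Suc n) - f n)"
    and hi: "\<And>n. Suc n < N \<Longrightarrow> (f (Suc (Suc n)) - f (Suc n)) - (f (Suc n) - f n) \<le> \<alpha> * \<rho>"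
  shows "norm (\<Sum>n<N. expi (f n)) \<le> 4 * \<alpha> * real N * sqrt \<rho> + 8 / sqrt \<rho>"
proof (cases "\<rho> \<le> 1/4 \<and> N > 0")
  \<comment> \<open>If \<rho> > 1/4, the claimed bound exceeds the number of terms. In the other
    case \<theta> \<le> 1/2, which is used to absorb 3/\<theta> + 2 into 4/\<theta>.\<close>
  case False
  have "norm (\<Sum>n<N. expi (f n)) \<le> real N"
    using norm_sum_expi_le_card[of f "{..<N}"] by simp
  also have "real N \<le> 4 * \<alpha> * real N * sqrt \<rho>"
  proof (cases "N = 0")
    case False
    with \<open>\<not> (\<rho> \<le> 1/4 \<and> N > 0)\<close> have "sqrt \<rho> \<ge> sqrt ((1/2)\<^sup>2)"
      by (intro real_sqrt_le_mono) (auto simp: power2_eq_square)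
    then have "sqrt \<rho> \<ge> 1/2" by simp
    then have "1 * 1 \<le> (2 * \<alpha>) * (2 * sqrt \<rho>)" using assms(2) by (intro mult_mono) auto
    then have "real N * 1 \<le> real N * ((2 * \<alpha>) * (2 * sqrt \<rho>))" by (intro mult_left_mono) auto
    then show ?thesis by (simp add: algebra_simps)
  qed auto
  finally have "norm (\<Sum>n<N. expi (f n)) \<le> 4 * \<alpha> * real N * sqrt \<rho>" .
  then show ?thesis using assms(1) by (simp add: add_increasing2)
next
  case True
  define \<theta> where "\<theta> = sqrt \<rho>"
  have \<theta>: "\<theta> > 0" "\<theta> * \<theta> = \<rho>" "\<theta> \<le> 1/2"
  proof -
    have "sqrt \<rho> \<le> sqrt ((1/2)\<^sup>2)" using True by (intro real_sqrt_le_mono) (auto simp: power2_eq_square)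
    then show "\<theta> \<le> 1/2" by (simp add: \<theta>_def)
  qed (use assms(1) in \<open>auto simp: \<theta>_def\<close>)
  define \<delta> where "\<delta> n = f (Suc n) - f n" for n
  have sp: "real (j - i) * \<rho> \<le> \<delta> j - \<delta> i \<and> \<delta> j - \<delta> i \<le> real (j - i) * (\<alpha> * \<rho>)"
    if "i \<le> j" "j < N" for i j
    using that
  proof (induction j rule: dec_induct)
    case (step n)
    then show ?case using lo[of n] hi[of n]
      by (auto simp: \<delta>_def Suc_diff_le distrib_right)
  qed auto
  have mono: "\<delta> i \<le> \<delta> j" if "i \<le> j" "j < N" for i j
  proof -
    have "0 \<le> real (j - i) * \<rho>" using assms(1) by simp
    then show ?thesis using sp[OF that] by linarith
  qed
  define V where "V = (\<lambda>n. \<lfloor>\<delta> n\<rfloor>) ` {..<N}"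
  have cls: "norm (\<Sum>n | n \<in> {..<N} \<and> \<lfloor>\<delta> n\<rfloor> = \<nu>. expi (f n)) \<le> 4 / \<theta>" for \<nu>
  proof -
    \<comment> \<open>\<open>I2\<close> does not mention the floor: its two bounds already force it,
      and in this form the monotonicity of \<delta> shows at once that \<open>I2\<close> is an
      interval of indices.\<close>
    define I1 I2 I3 where "I1 = {n \<in> {..<N}. \<lfloor>\<delta> n\<rfloor> = \<nu> \<and> \<delta> n < of_int \<nu> + \<theta>}"
      and "I2 = {n \<in> {..<N}. of_int \<nu> + \<theta> \<le> \<delta> n \<and> \<delta> n \<le> of_int \<nu> + 1 - \<theta>}"
      and "I3 = {n \<in> {..<N}. \<lfloor>\<delta> n\<rfloor> = \<nu> \<and> \<delta> n \<ge> of_int \<nu> + \<theta> \<and> \<delta> n > of_int \<nu> + 1 - \<theta>}"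
    have fl: "of_int \<nu> \<le> \<delta> n \<and> \<delta> n < of_int \<nu> + 1" if "\<lfloor>\<delta> n\<rfloor> = \<nu>" for n
      using that floor_eq_iff by blast
    have fin: "finite I1" "finite I2" "finite I3" by (auto simp: I1_def I2_def I3_def)
    have I2f: "\<lfloor>\<delta> n\<rfloor> = \<nu>" if "n \<in> I2" for n
    proof -
      have "of_int \<nu> \<le> \<delta> n" "\<delta> n < of_int \<nu> + 1" using that \<theta>(1) unfolding I2_def by auto
      then show ?thesis by (simp add: floor_eq_iff)
    qed
    have "{n. n \<in> {..<N} \<and> \<lfloor>\<delta> n\<rfloor> = \<nu>} = (I1 \<union> I2) \<union> I3"
    proof (rule set_eqI)
      fix n
      show "n \<in> {n. n \<in> {..<N} \<and> \<lfloor>\<delta> n\<rfloor> = \<nu>} \<longleftrightarrow> n \<in> (I1 \<union> I2) \<union> I3"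
        using I2f[of n] unfolding I1_def I2_def I3_def Un_iff mem_Collect_eq by (meson not_le)
    qed
    then have "(\<Sum>n | n \<in> {..<N} \<and> \<lfloor>\<delta> n\<rfloor> = \<nu>. expi (f n))
        = (\<Sum>n\<in>(I1 \<union> I2) \<union> I3. expi (f n))" by simp
    also have "\<dots> = (\<Sum>n\<in>I1. expi (f n)) + (\<Sum>n\<in>I2. expi (f n)) + (\<Sum>n\<in>I3. expi (f n))"
    proof -
      have "I1 \<inter> I2 = {}" "(I1 \<union> I2) \<inter> I3 = {}" unfolding I1_def I2_def I3_def by fastforce+
      then show ?thesis using fin by (simp add: sum.union_disjoint)
    qed
    also have "norm \<dots> \<le> norm (\<Sum>n\<in>I1. expi (f n)) + norm (\<Sum>n\<in>I2. expi (f n)) + norm (\<Sum>n\<in>I3. expi (f n))"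
      by (meson norm_triangle_ineq add_right_mono order_trans)
    also have "norm (\<Sum>n\<in>I1. expi (f n)) \<le> \<theta> / \<rho> + 1"
    proof -
      have "real (card I1) \<le> \<theta> / \<rho> + 1"
      proof (rule card_spaced_le[OF assms(1)])
        show "\<theta> \<ge> 0" using \<theta>(1) by simp
        show "I1 \<subseteq> {..<N}" by (auto simp: I1_def)
        show "of_int \<nu> \<le> \<delta> n \<and> \<delta> n \<le> of_int \<nu> + \<theta>" if "n \<in> I1" for n
          using that fl[of n] unfolding I1_def by auto
        show "real (j - i) * \<rho> \<le> \<delta> j - \<delta> i" if "i \<le> j" "j < N" for i j
          using sp[OF that] by blast
      qed
      then show ?thesis using norm_sum_expi_le_card[of f I1] by simp
    qed
    also have "norm (\<Sum>n\<in>I3. expi (f n)) \<le> \<theta> / \<rho> + 1"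
    proof -
      have "real (card I3) \<le> \<theta> / \<rho> + 1"
      proof (rule card_spaced_le[OF assms(1)])
        show "\<theta> \<ge> 0" using \<theta>(1) by simp
        show "I3 \<subseteq> {..<N}" by (auto simp: I3_def)
        show "of_int \<nu> + 1 - \<theta> \<le> \<delta> n \<and> \<delta> n \<le> of_int \<nu> + 1 - \<theta> + \<theta>" if "n \<in> I3" for n
          using that fl[of n] unfolding I3_def by auto
        show "real (j - i) * \<rho> \<le> \<delta> j - \<delta> i" if "i \<le> j" "j < N" for i j
          using sp[OF that] by blast
      qed
      then show ?thesis using norm_sum_expi_le_card[of f I3] by simp
    qed
    also have "norm (\<Sum>n\<in>I2. expi (f n)) \<le> 1 / \<theta>"
    proof (rule kusmin_landau_set[OF \<theta>(1) fin(2)])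
      show "j \<in> I2" if "i \<in> I2" "k \<in> I2" "i \<le> j" "j \<le> k" for i j k
        using that mono[of i j] mono[of j k] by (auto simp: I2_def)
      show "of_int \<nu> + \<theta> \<le> f (Suc n) - f n \<and> f (Suc n) - f n \<le> of_int \<nu> + 1 - \<theta>" if "n \<in> I2" for n
        using that by (auto simp: I2_def \<delta>_def)
      show "f (Suc n) - f n \<le> f (Suc (Suc n)) - f (Suc n)" if "n \<in> I2" "Suc n \<in> I2" for n
        using mono[of n "Suc n"] that by (auto simp: I2_def \<delta>_def)
    qed
    also have "\<theta> / \<rho> + 1 + 1 / \<theta> + (\<theta> / \<rho> + 1) = 3 / \<theta> + 2"
      using \<theta>(1) by (simp add: field_simps flip: \<theta>(2))
    also have "\<dots> \<le> 4 / \<theta>" using \<theta> by (simp add: field_simps)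
    finally show ?thesis by simp
  qed
  \<comment> \<open>The total increase of \<delta> is at most \<alpha>\<rho>N; an interval of that
    length meets at most two more integer parts than its length.\<close>
  have cV: "real (card V) \<le> \<alpha> * \<rho> * real N + 2"
  proof -
    have "V \<subseteq> {\<lfloor>\<delta> 0\<rfloor>..\<lfloor>\<delta> (N - 1)\<rfloor>}"
      using mono True by (auto simp: V_def intro!: floor_mono)
    then have "card V \<le> card {\<lfloor>\<delta> 0\<rfloor>..\<lfloor>\<delta> (N - 1)\<rfloor>}" by (intro card_mono) auto
    moreover have "\<lfloor>\<delta> 0\<rfloor> \<le> \<lfloor>\<delta> (N - 1)\<rfloor>" using mono[of 0 "N - 1"] True by (auto intro!: floor_mono)
    ultimately have "real (card V) \<le> of_int (\<lfloor>\<delta> (N - 1)\<rfloor> - \<lfloor>\<delta> 0\<rfloor> + 1)" by simp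
    also have "\<dots> \<le> \<delta> (N - 1) - \<delta> 0 + 2" by simp linarith
    also have "\<delta> (N - 1) - \<delta> 0 \<le> real (N - 1) * (\<alpha> * \<rho>)" using sp[of 0 "N - 1"] True by auto
    also have "\<dots> \<le> real N * (\<alpha> * \<rho>)" using assms by (intro mult_right_mono) auto
    finally show ?thesis by (simp add: algebra_simps)
  qed
  have "(\<Sum>n<N. expi (f n)) = (\<Sum>\<nu>\<in>V. \<Sum>n | n \<in> {..<N} \<and> \<lfloor>\<delta> n\<rfloor> = \<nu>. expi (f n))"
    unfolding V_def by (rule sum.image_gen) auto
  also have "norm \<dots> \<le> (\<Sum>\<nu>\<in>V. 4 / \<theta>)" by (rule sum_norm_le) (rule cls)
  also have "\<dots> = real (card V) * (4 / \<theta>)" by simp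
  also have "\<dots> \<le> (\<alpha> * \<rho> * real N + 2) * (4 / \<theta>)" using cV \<theta> by (intro mult_right_mono) auto
  also have "\<dots> = 4 * \<alpha> * real N * \<theta> + 8 / \<theta>" using \<theta>(1) by (simp add: field_simps flip: \<theta>(2))
  finally show ?thesis by (simp add: \<theta>_def)
qed

section \<open>The Weyl--van der Corput inequality and the third derivative test\<close>

lemma cmod_sum_squared_le:
  fixes a :: "'a \<Rightarrow> complex"
  shows "(norm (\<Sum>i\<in>I. a i))\<^sup>2 \<le> real (card I) * (\<Sum>i\<in>I. (norm (a i))\<^sup>2)"
proof -
  have "(norm (\<Sum>i\<in>I. a i))\<^sup>2 \<le> (\<Sum>i\<in>I. 1 * norm (a i))\<^sup>2"
    by (intro power_mono) (simp_all add: norm_sum)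
  also have "\<dots> \<le> (\<Sum>i\<in>I. 1\<^sup>2) * (\<Sum>i\<in>I. (norm (a i))\<^sup>2)"
    by (rule Cauchy_Schwarz_ineq_sum)
  finally show ?thesis by simp
qed

text \<open>The sum is averaged over its \<open>H\<close> translates before Cauchy--Schwarz is applied.\<close>
lemma weyl_van_der_corput:
  fixes f :: "nat \<Rightarrow> real" and G :: "nat \<Rightarrow> real"
  assumes G: "\<And>j. 0 < j \<Longrightarrow> j < H \<Longrightarrow> norm (\<Sum>n<N-j. expi (f (n + j) - f n)) \<le> G j"
    and H: "H > 0"
  shows "real H * (norm (\<Sum>n<N. expi (f n)))\<^sup>2 \<le> real (N + H) * (real N + 2 * (\<Sum>j=1..<H. G j))"
proof -
  \<comment> \<open>Extending the summand by zero to all integers lets every translate by h < H be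
    summed over the same range \<open>R\<close> of N + H points. The correlations
    \<open>C h k\<close> then depend only on the lag k - h.\<close>
  define w :: "int \<Rightarrow> complex" where "w n = (if 0 \<le> n \<and> n < int N then expi (f (nat n)) else 0)" for n
  define R where "R = {0..<int N + int H}"
  define S where "S = (\<Sum>n<N. expi (f n))"
  define C where "C h k = (\<Sum>m\<in>R. w (m - int h) * cnj (w (m - int k)))" for h k
  have finR: "finite R" by (simp add: R_def)
  have shift: "(\<Sum>m\<in>R. w (m - int h)) = S" if "h < H" for h
  proof -
    have "(\<Sum>m\<in>R. w (m - int h)) = (\<Sum>m\<in>{int h..<int h + int N}. w (m - int h))"
      by (rule sum.mono_neutral_right) (use that in \<open>auto simp: R_def w_def\<close>)
    also have "\<dots> = S" unfolding S_def
      by (rule sum.reindex_bij_witness[where i = "\<lambda>n. int h + int n" and j = "\<lambda>m. nat (m - int h)"])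
        (auto simp: w_def)
    finally show ?thesis .
  qed
  have corr: "C h (h + j) = (\<Sum>n<N-j. expi (f (n + j) - f n))" if "h + j < H" for h j
  proof -
    have "C h (h + j) = (\<Sum>m\<in>{int (h + j)..<int (h + j) + int (N - j)}. w (m - int h) * cnj (w (m - int (h + j))))"
      unfolding C_def by (rule sum.mono_neutral_right) (use that in \<open>auto simp: R_def w_def\<close>)
    also have "\<dots> = (\<Sum>n<N-j. expi (f (n + j) - f n))"
    proof (rule sum.reindex_bij_witness[where i = "\<lambda>n. int (h + j) + int n" and j = "\<lambda>m. nat (m - int (h + j))"])
      fix m assume m: "m \<in> {int (h + j)..<int (h + j) + int (N - j)}"
      define n where "n = nat (m - int (h + j))"
      have mn: "m = int (h + j) + int n" and n: "n < N - j" using m by (auto simp: n_def)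
      have "w (m - int h) = expi (f (n + j))" "w (m - int (h + j)) = expi (f n)"
        using n by (auto simp: mn w_def nat_add_distrib add.commute)
      then show "expi (f (nat (m - int (h + j)) + j) - f (nat (m - int (h + j))))
          = w (m - int h) * cnj (w (m - int (h + j)))"
        unfolding n_def[symmetric] by (simp only: cnj_expi flip: expi_add) simp
    qed auto
    finally show ?thesis .
  qed
  have sym: "norm (C h k) = norm (C k h)" for h k
  proof -
    have "C h k = cnj (C k h)" by (simp add: C_def mult.commute)
    then show ?thesis by simp
  qed
  have G0: "G j \<ge> 0" if "0 < j" "j < H" for j
    using G[OF that] norm_ge_zero order_trans by blast
  \<comment> \<open>In one row of this Toeplitz matrix the diagonal gives N, and each lag j occurs
    at most once on either side of it.\<close>
  have row: "(\<Sum>k<H. norm (C h k)) \<le> real N + 2 * (\<Sum>j=1..<H. G j)" if "h < H" for h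
  proof -
    have "(\<Sum>k<H. norm (C h k)) = (\<Sum>k<h. norm (C h k)) + norm (C h h) + (\<Sum>k\<in>{h<..<H}. norm (C h k))"
    proof -
      have "{..<H} = insert h ({..<h} \<union> {h<..<H})" using that by auto
      moreover have "{..<h} \<inter> {h<..<H} = {}" by auto
      ultimately show ?thesis by (simp add: sum.union_disjoint)
    qed
    also have "norm (C h h) = real N"
      using corr[of h 0] that by (simp add: norm_mult)
    also have "(\<Sum>k<h. norm (C h k)) \<le> (\<Sum>j=1..<H. G j)"
    proof -
      have "(\<Sum>k<h. norm (C h k)) \<le> (\<Sum>k<h. G (h - k))"
      proof (rule sum_mono)
        fix k assume k: "k \<in> {..<h}"
        show "norm (C h k) \<le> G (h - k)"
          unfolding sym[of h k] using corr[of k "h - k"] G[of "h - k"] k that by auto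
      qed
      also have "\<dots> = (\<Sum>j\<in>{1..<h+1}. G j)"
        by (rule sum.reindex_bij_witness[where i = "\<lambda>j. h - j" and j = "\<lambda>k. h - k"]) auto
      also have "\<dots> \<le> (\<Sum>j=1..<H. G j)"
        using that G0 by (intro sum_mono2) auto
      finally show ?thesis .
    qed
    also have "(\<Sum>k\<in>{h<..<H}. norm (C h k)) \<le> (\<Sum>j=1..<H. G j)"
    proof -
      have "(\<Sum>k\<in>{h<..<H}. norm (C h k)) \<le> (\<Sum>k\<in>{h<..<H}. G (k - h))"
      proof (rule sum_mono)
        fix k assume k: "k \<in> {h<..<H}"
        show "norm (C h k) \<le> G (k - h)"
          using corr[of h "k - h"] G[of "k - h"] k by auto
      qed
      also have "\<dots> = (\<Sum>j\<in>{1..<H-h}. G j)"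
        by (rule sum.reindex_bij_witness[where i = "\<lambda>j. h + j" and j = "\<lambda>k. k - h"]) auto
      also have "\<dots> \<le> (\<Sum>j=1..<H. G j)"
        using that G0 by (intro sum_mono2) auto
      finally show ?thesis .
    qed
    finally show ?thesis by simp
  qed
  have "of_nat H * S = (\<Sum>h<H. \<Sum>m\<in>R. w (m - int h))"
    by (simp add: shift)
  also have "\<dots> = (\<Sum>m\<in>R. \<Sum>h<H. w (m - int h))" by (rule sum.swap)
  finally have "(real H * norm S)\<^sup>2 = (norm (\<Sum>m\<in>R. \<Sum>h<H. w (m - int h)))\<^sup>2"
    by (metis norm_mult norm_of_nat)
  also have "\<dots> \<le> real (card R) * (\<Sum>m\<in>R. (norm (\<Sum>h<H. w (m - int h)))\<^sup>2)"
    by (rule cmod_sum_squared_le)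
  finally have sq: "(real H * norm S)\<^sup>2 \<le> real (card R) * (\<Sum>m\<in>R. (norm (\<Sum>h<H. w (m - int h)))\<^sup>2)" .
  have "(\<Sum>m\<in>R. (norm (\<Sum>h<H. w (m - int h)))\<^sup>2) = Re (\<Sum>h<H. \<Sum>k<H. C h k)"
  proof -
    have "complex_of_real (\<Sum>m\<in>R. (norm (\<Sum>h<H. w (m - int h)))\<^sup>2)
        = (\<Sum>m\<in>R. \<Sum>h<H. \<Sum>k<H. w (m - int h) * cnj (w (m - int k)))"
      by (simp add: complex_norm_square sum_product flip: of_real_power)
    also have "\<dots> = (\<Sum>h<H. \<Sum>k<H. C h k)"
      unfolding C_def by (subst sum.swap, subst (2) sum.swap) simp
    finally show ?thesis by (metis Re_complex_of_real)
  qed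
  also have "Re (\<Sum>h<H. \<Sum>k<H. C h k) \<le> (\<Sum>h<H. \<Sum>k<H. norm (C h k))"
    by (intro order_trans[OF complex_Re_le_cmod] sum_norm_le) (simp add: norm_sum)
  also have "\<dots> \<le> (\<Sum>h<H. real N + 2 * (\<Sum>j=1..<H. G j))"
    by (rule sum_mono, rule row) simp
  finally have "(\<Sum>m\<in>R. (norm (\<Sum>h<H. w (m - int h)))\<^sup>2)
      \<le> real H * (real N + 2 * (\<Sum>j=1..<H. G j))" by simp
  then have "real (card R) * (\<Sum>m\<in>R. (norm (\<Sum>h<H. w (m - int h)))\<^sup>2)
      \<le> real (N + H) * (real H * (real N + 2 * (\<Sum>j=1..<H. G j)))"
    by (intro mult_mono) (auto simp: R_def sum_nonneg)
  with sq have "real H * (real H * (norm S)\<^sup>2) \<le> real H * (real (N + H) * (real N + 2 * (\<Sum>j=1..<H. G j)))"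
    by (simp add: power2_eq_square mult_ac)
  then show ?thesis using H by (simp add: S_def)
qed

section \<open>The derivative tests for the phase y/m on one dyadic block\<close>

lemma second_difference_reciprocal:
  fixes y m :: real
  assumes "m > 0"
  shows "(y / (m + 2) - y / (m + 1)) - (y / (m + 1) - y / m) = 2 * y / (m * (m + 1) * (m + 2))"
  using assms by (simp add: divide_simps) algebra

lemma third_difference_reciprocal:
  fixes y m :: real
  assumes "m > 0"
  shows "2 * y / (m * (m + 1) * (m + 2)) - 2 * y / ((m + 1) * (m + 2) * (m + 3))
    = 6 * y / (m * (m + 1) * (m + 2) * (m + 3))"
  using assms by (simp add: divide_simps) algebra

text \<open>All three factors of m(m+1)(m+2) lie between D and 2D, so the second differences lie
  between \<rho> = y/(4D^3) and 8\<rho>.\<close>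

lemma expi_sum_reciprocal_second:
  fixes y :: real
  assumes "y > 0" "D > 0" "N \<le> D" "real D ^ 2 \<le> y"
  shows "norm (\<Sum>n<N. expi (y / real (D + n))) \<le> 32 * sqrt (y / real D)"
proof -
  define d where "d = real D"
  have d: "d > 0" "d \<ge> 1" using assms(2) by (auto simp: d_def)
  define \<rho> where "\<rho> = y / (4 * d ^ 3)"
  have \<rho>: "\<rho> > 0" using assms(1) d by (simp add: \<rho>_def)
  have sd: "(y / real (D + Suc (Suc n)) - y / real (D + Suc n)) - (y / real (D + Suc n) - y / real (D + n))
      = 2 * y / ((d + real n) * (d + real n + 1) * (d + real n + 2))" for n
    using second_difference_reciprocal[of "d + real n" y] d by (simp add: d_def algebra_simps)
  have "norm (\<Sum>n<N. expi (y / real (D + n))) \<le> 4 * 8 * real N * sqrt \<rho> + 8 / sqrt \<rho>"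
  proof (rule expi_sum_second_difference[OF \<rho>])
    fix n assume "Suc n < N"
    then have n: "real n + 2 \<le> d" using assms(3) by (simp add: d_def)
    have P: "(d + real n) * (d + real n + 1) * (d + real n + 2) \<le> (2 * d) * (2 * d) * (2 * d)"
        "d * d * d \<le> (d + real n) * (d + real n + 1) * (d + real n + 2)"
      by (intro mult_mono; use n d in simp)+
    have pos: "(d + real n) * (d + real n + 1) * (d + real n + 2) > 0"
      using d by (intro mult_pos_pos) auto
    have "\<rho> = 2 * y / ((2 * d) * (2 * d) * (2 * d))"
      using d by (simp add: \<rho>_def power3_eq_cube field_simps)
    also have "\<dots> \<le> 2 * y / ((d + real n) * (d + real n + 1) * (d + real n + 2))"
      using P pos assms(1) d by (intro divide_left_mono) auto
    finally show "\<rho> \<le> (y / real (D + Suc (Suc n)) - y / real (D + Suc n)) - (y / real (D + Suc n) - y / real (D + n))"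
      by (simp only: sd)
    have "2 * y / ((d + real n) * (d + real n + 1) * (d + real n + 2)) \<le> 2 * y / (d * d * d)"
      using P pos assms(1) d by (intro divide_left_mono) auto
    also have "\<dots> = 8 * \<rho>" using d by (simp add: \<rho>_def power3_eq_cube field_simps)
    finally show "(y / real (D + Suc (Suc n)) - y / real (D + Suc n)) - (y / real (D + Suc n) - y / real (D + n)) \<le> 8 * \<rho>"
      by (simp only: sd)
  qed simp
  also have "\<dots> \<le> 32 * d * sqrt \<rho> + 8 / sqrt \<rho>"
    using assms(3) \<rho> by (simp add: d_def mult_right_mono)
  also have "d * sqrt \<rho> = sqrt (y / d) / 2"
  proof -
    have "d * sqrt \<rho> = sqrt (d\<^sup>2 * \<rho>)" using d by (simp add: real_sqrt_mult)
    also have "d\<^sup>2 * \<rho> = (y / d) / 2\<^sup>2" using d by (simp add: \<rho>_def power_numeral_reduce)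
    finally have "d * sqrt \<rho> = sqrt ((y / d) / 2\<^sup>2)" .
    then show ?thesis by (simp only: real_sqrt_divide real_sqrt_abs abs_numeral)
  qed
  then have "32 * d * sqrt \<rho> = 16 * sqrt (y / d)" by simp
  \<comment> \<open>Equivalent to D^4 \<le> y^2; this is where the hypothesis D^2 \<le> y
    enters.\<close>
  also have "8 / sqrt \<rho> \<le> 16 * sqrt (y / d)"
  proof -
    have "1 \<le> sqrt (4 * (\<rho> * (y / d)))"
    proof -
      have "d ^ 2 * d ^ 2 \<le> y * y" using assms(1,4) by (intro mult_mono) (auto simp: d_def)
      then show ?thesis using d assms(1) by (simp add: \<rho>_def power_numeral_reduce field_simps)
    qed
    also have "\<dots> = 2 * (sqrt \<rho> * sqrt (y / d))" by (simp only: real_sqrt_mult) simp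
    finally show ?thesis using \<rho> by (simp add: field_simps)
  qed
  finally show ?thesis by (simp add: d_def)
qed

text \<open>The second difference of the phase shifted by j is a sum of j third differences
  6y/(m(m+1)(m+2)(m+3)), each between 3\<mu>/8 and 6\<mu>: a ratio of 16. The sign is reversed in
  \<open>g\<close> to make second differences positive, and conjugation undoes this at the
  end.\<close>

lemma expi_sum_reciprocal_difference:
  fixes y :: real
  assumes "y > 0" "D > 0" "N \<le> D" "j > 0" "\<mu> = y / real D ^ 4"
  shows "norm (\<Sum>n<N-j. expi (y / real (D + (n + j)) - y / real (D + n)))
      \<le> 40 * real D * sqrt (\<mu> * real j) + (40/3) / sqrt (\<mu> * real j)"
proof -
  define d where "d = real D"
  have d: "d > 0" "d \<ge> 1" using assms(2) by (auto simp: d_def)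
  define g where "g n = y / real (D + n) - y / real (D + (n + j))" for n
  define \<rho> where "\<rho> = 3/8 * (\<mu> * real j)"
  have \<mu>: "\<mu> > 0" "\<mu> = y / d ^ 4" using assms(1,5) d by (auto simp: d_def)
  have \<rho>: "\<rho> > 0" using \<mu>(1) assms(4) by (simp add: \<rho>_def)
  define s where "s m = 2 * y / (m * (m + 1) * (m + 2))" for m
  have sd: "(y / real (D + Suc (Suc n)) - y / real (D + Suc n)) - (y / real (D + Suc n) - y / real (D + n))
      = s (d + real n)" for n
    using second_difference_reciprocal[of "d + real n" y] d by (simp add: s_def d_def algebra_simps)
  have step: "3/8 * \<mu> \<le> s m - s (m + 1) \<and> s m - s (m + 1) \<le> 6 * \<mu>" if "d \<le> m" "m + 3 \<le> 2 * d" for m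
  proof -
    have P: "m * (m + 1) * (m + 2) * (m + 3) \<le> (2 * d) * (2 * d) * (2 * d) * (2 * d)"
        "d * d * d * d \<le> m * (m + 1) * (m + 2) * (m + 3)"
      by (intro mult_mono; use that d in simp)+
    have pos: "m * (m + 1) * (m + 2) * (m + 3) > 0" using that d by auto
    have e: "s m - s (m + 1) = 6 * y / (m * (m + 1) * (m + 2) * (m + 3))"
      using third_difference_reciprocal[of m y] that d by (simp add: s_def add.assoc)
    have "6 * y / ((2 * d) * (2 * d) * (2 * d) * (2 * d)) \<le> s m - s (m + 1)"
      unfolding e using P pos assms(1) d by (intro divide_left_mono) auto
    moreover have "s m - s (m + 1) \<le> 6 * y / (d * d * d * d)"
      unfolding e using P pos assms(1) d by (intro divide_left_mono) auto
    ultimately show ?thesis using d by (simp add: \<mu> power_numeral_reduce)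
  qed
  have steps: "real i * (3/8 * \<mu>) \<le> s m - s (m + real i) \<and> s m - s (m + real i) \<le> real i * (6 * \<mu>)"
    if "d \<le> m" "m + real i + 2 \<le> 2 * d" for i m
    using that
  proof (induction i)
    case (Suc i)
    then have "real i * (3/8 * \<mu>) \<le> s m - s (m + real i) \<and> s m - s (m + real i) \<le> real i * (6 * \<mu>)"
      by simp
    moreover have "3/8 * \<mu> \<le> s (m + real i) - s (m + real i + 1) \<and> s (m + real i) - s (m + real i + 1) \<le> 6 * \<mu>"
      using Suc.prems by (intro step) auto
    ultimately show ?case by (simp add: distrib_right add_ac)
  qed simp
  have gsd: "(g (Suc (Suc n)) - g (Suc n)) - (g (Suc n) - g n) = s (d + real n) - s (d + real n + real j)" for n
    using sd[of n] sd[of "n + j"] by (simp add: g_def add_ac)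
  have "norm (\<Sum>n<N-j. expi (g n)) \<le> 4 * 16 * real (N - j) * sqrt \<rho> + 8 / sqrt \<rho>"
  proof (rule expi_sum_second_difference[OF \<rho>])
    fix n assume "Suc n < N - j"
    then have "real n + real j + 2 \<le> d" using assms(3) by (simp add: d_def)
    then have "real j * (3/8 * \<mu>) \<le> s (d + real n) - s (d + real n + real j)
        \<and> s (d + real n) - s (d + real n + real j) \<le> real j * (6 * \<mu>)"
      by (intro steps) auto
    then show "\<rho> \<le> (g (Suc (Suc n)) - g (Suc n)) - (g (Suc n) - g n)"
      "(g (Suc (Suc n)) - g (Suc n)) - (g (Suc n) - g n) \<le> 16 * \<rho>"
      unfolding gsd by (simp_all add: \<rho>_def mult_ac)
  qed simp
  also have "\<dots> \<le> 64 * d * sqrt \<rho> + 8 / sqrt \<rho>"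
    using assms(3) \<rho> by (simp add: d_def mult_right_mono)
  \<comment> \<open>The irrational factor sqrt(3/8) is replaced by the rational bounds 3/5 below and
    5/8 above, which produces 40/3 and 40.\<close>
  also have "64 * d * sqrt \<rho> \<le> 40 * d * sqrt (\<mu> * real j)"
  proof -
    have "sqrt \<rho> \<le> sqrt ((5/8)\<^sup>2 * (\<mu> * real j))"
      using \<mu>(1) unfolding \<rho>_def by (intro real_sqrt_le_mono mult_right_mono) (auto simp: power2_eq_square)
    also have "\<dots> = 5/8 * sqrt (\<mu> * real j)" by (simp only: real_sqrt_mult) simp
    finally have "64 * d * sqrt \<rho> \<le> 64 * d * (5/8 * sqrt (\<mu> * real j))" using d by (intro mult_left_mono) auto
    then show ?thesis by simp
  qed
  also have "8 / sqrt \<rho> \<le> (40/3) / sqrt (\<mu> * real j)"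
  proof -
    have "sqrt ((3/5)\<^sup>2 * (\<mu> * real j)) \<le> sqrt \<rho>"
      using \<mu>(1) unfolding \<rho>_def by (intro real_sqrt_le_mono mult_right_mono) (auto simp: power2_eq_square)
    also have "sqrt ((3/5)\<^sup>2 * (\<mu> * real j)) = 3/5 * sqrt (\<mu> * real j)" by (simp only: real_sqrt_mult) simp
    finally have "8 / sqrt \<rho> \<le> 8 / (3/5 * sqrt (\<mu> * real j))"
      using \<rho> \<mu>(1) assms(4) by (intro divide_left_mono) auto
    then show ?thesis by simp
  qed
  finally have "norm (\<Sum>n<N-j. expi (g n)) \<le> 40 * d * sqrt (\<mu> * real j) + (40/3) / sqrt (\<mu> * real j)"
    by simp
  moreover have "expi (y / real (D + (n + j)) - y / real (D + n)) = expi (- g n)" for n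
    by (simp add: g_def)
  ultimately show ?thesis using sum_cnj_expi[of g "{..<N-j}"] by (simp only: d_def)
qed

lemma sum_inverse_sqrt_le: "(\<Sum>j=1..n. 1 / sqrt (real j)) \<le> 2 * sqrt (real n)"
proof (induction n)
  case (Suc n)
  define a b where "a = sqrt (real n)" and "b = sqrt (real (Suc n))"
  have ab: "a \<ge> 0" "b > 0" "a \<le> b" "b\<^sup>2 = a\<^sup>2 + 1" by (auto simp: a_def b_def)
  have "1 = (b - a) * (b + a)" using ab(4) by (simp add: algebra_simps power2_eq_square)
  also have "\<dots> \<le> (b - a) * (2 * b)" using ab by (intro mult_left_mono) auto
  finally have "1 / b \<le> 2 * (b - a)" using ab(2) by (simp add: field_simps)
  then show ?case using Suc.IH by (simp add: a_def b_def)
qed auto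

text \<open>Weyl--van der Corput gives S^2 of order d^2/H + d^2 sqrt(\<mu>H) + d/sqrt(\<mu>H). The
  first two terms balance at H = 1/r with r^3 = \<mu>, both being r d^2. The third is of order d/r,
  which is at most r d^2 because r^2 d \<ge> 1, and that is the hypothesis D^5 \<le> y^2.\<close>

lemma expi_sum_reciprocal_third:
  fixes y :: real
  assumes "y > 0" "D > 0" "N \<le> D" "real D ^ 2 \<le> y" "real D ^ 5 \<le> y\<^sup>2"
  shows "norm (\<Sum>n<N. expi (y / real (D + n))) \<le> 18 * (real D ^ 2 * y) powr (1/6)"
proof -
  define d where "d = real D"
  have d: "d > 0" "d \<ge> 1" using assms(2) by (auto simp: d_def)
  define \<mu> where "\<mu> = y / d ^ 4"
  have \<mu>: "\<mu> > 0" using assms(1) d by (simp add: \<mu>_def)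
  define r where "r = \<mu> powr (1/3)"
  have r: "r > 0" "r ^ 3 = \<mu>" using \<mu> by (auto simp: r_def powr_power)
  define S where "S = norm (\<Sum>n<N. expi (y / real (D + n)))"
  have SN: "S \<le> real N" using norm_sum_expi_le_card[of _ "{..<N}"] by (simp add: S_def)
  have Nd: "real N \<le> d" using assms(3) by (simp add: d_def)
  have r2d: "1 \<le> r\<^sup>2 * d"
  proof -
    have "(r\<^sup>2 * d) ^ 3 = (r ^ 3)\<^sup>2 * d ^ 3" by (simp add: power_mult_distrib flip: power_mult)
    also have "\<dots> = y\<^sup>2 / d ^ 5"
      using d by (simp add: r(2) \<mu>_def power_divide field_simps flip: power_mult power_add)
    also have "\<dots> \<ge> 1" using assms(5) d by (simp add: d_def)
    finally have "1 \<le> (r\<^sup>2 * d) ^ 3" .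
    then show ?thesis using power_strict_mono[of "r\<^sup>2 * d" 1 3] d r(1) by force
  qed
  have r3d: "1 \<le> r ^ 3 * d\<^sup>2"
  proof -
    have "r ^ 3 * d\<^sup>2 = y / d\<^sup>2"
      using d by (simp only: r(2) \<mu>_def) (simp add: power_numeral_reduce field_simps)
    then show ?thesis using assms(4) d by (simp add: d_def)
  qed
  have main: "S\<^sup>2 \<le> 324 * (r * d\<^sup>2)"
  proof -
    \<comment> \<open>Both degenerate cases are trivial: H = 0 means r > 1, so already d^2 \<le> r
      d^2; if H > N, then S \<le> N \<le> 1/r, and r^3 d^2 \<ge> 1, which is D^2 \<le> y,
      suffices.\<close>
    define H where "H = nat \<lfloor>1 / r\<rfloor>"
    consider "H = 0" | "N < H" | "0 < H" "H \<le> N" by linarith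
    then show ?thesis
    proof cases
      case 1
      then have "1 / r < 1" using r(1) by (simp add: H_def)
      then have "r > 1" using r(1) by (simp add: field_simps)
      have "S\<^sup>2 \<le> d\<^sup>2" using SN Nd by (intro power_mono) (auto simp: S_def)
      also have "\<dots> \<le> 324 * r * d\<^sup>2" using \<open>r > 1\<close> d by (simp add: mult_le_cancel_right1)
      finally show ?thesis by simp
    next
      case 2
      then have "real N \<le> 1 / r" using r(1) unfolding H_def by linarith
      then have "S \<le> 1 / r" using SN by simp
      then have "S\<^sup>2 \<le> (1 / r)\<^sup>2" by (intro power_mono) (auto simp: S_def)
      also have "\<dots> \<le> r * d\<^sup>2" using r3d r(1) by (simp add: field_simps power_numeral_reduce)
      also have "\<dots> \<le> 324 * (r * d\<^sup>2)" using r(1) d by simp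
      finally show ?thesis .
    next
      case 3
      have H: "real H \<le> 1 / r" "1 / (2 * r) \<le> real H" "real H \<ge> 1"
      proof -
        show "real H \<le> 1 / r" using r(1) unfolding H_def by simp
        show "real H \<ge> 1" using 3 by simp
        moreover have "1 / r < real H + 1" using r(1) unfolding H_def by linarith
        ultimately show "1 / (2 * r) \<le> real H" by simp
      qed
      define u where "u = sqrt (\<mu> * real H)"
      have u: "u > 0" using \<mu> 3 by (simp add: u_def)
      have u1: "u \<le> r"
      proof -
        have "\<mu> * real H \<le> \<mu> * (1 / r)" using H \<mu> by (intro mult_left_mono) auto
        also have "\<dots> = r\<^sup>2" using r by (simp add: power_numeral_reduce field_simps flip: r(2))
        finally show ?thesis using r(1) by (simp add: u_def real_le_lsqrt)
      qed
      \<comment> \<open>H \<ge> 1/(2r) gives u \<ge> r/sqrt 2, and 7/10 is a rational lower bound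
        for 1/sqrt 2.\<close>
      have u2: "7/10 * r \<le> u"
      proof -
        have "(7/10 * r)\<^sup>2 \<le> \<mu> * (1 / (2 * r))" using r(1) by (simp add: power_numeral_reduce field_simps flip: r(2))
        also have "\<dots> \<le> \<mu> * real H" using H \<mu> by (intro mult_left_mono) auto
        finally show ?thesis unfolding u_def by (rule real_le_rsqrt)
      qed
      define G where "G j = 40 * d * sqrt (\<mu> * real j) + (40/3) / sqrt (\<mu> * real j)" for j
      have "(\<Sum>j=1..<H. G j) = 40 * d * (\<Sum>j=1..<H. sqrt (\<mu> * real j)) + (40/3) * (\<Sum>j=1..<H. 1 / sqrt (\<mu> * real j))"
        by (simp add: G_def sum.distrib sum_distrib_left)
      also have "(\<Sum>j=1..<H. sqrt (\<mu> * real j)) \<le> real H * u"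
      proof -
        have "(\<Sum>j=1..<H. sqrt (\<mu> * real j)) \<le> (\<Sum>j=1..<H. u)"
          using \<mu> by (intro sum_mono) (auto simp: u_def)
        also have "\<dots> \<le> real H * u" using u by (simp add: mult_right_mono)
        finally show ?thesis .
      qed
      also have "(\<Sum>j=1..<H. 1 / sqrt (\<mu> * real j)) \<le> 2 * real H / u"
      proof -
        have "(\<Sum>j=1..<H. 1 / sqrt (\<mu> * real j)) \<le> (\<Sum>j=1..H. 1 / sqrt (\<mu> * real j))"
          using \<mu> by (intro sum_mono2) auto
        also have "\<dots> = (1 / sqrt \<mu>) * (\<Sum>j=1..H. 1 / sqrt (real j))"
          by (simp add: real_sqrt_mult sum_distrib_left)
        also have "\<dots> \<le> (1 / sqrt \<mu>) * (2 * sqrt (real H))"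
          using sum_inverse_sqrt_le[of H] \<mu> by (intro mult_left_mono) auto
        also have "\<dots> = 2 * real H / u"
          using \<mu> 3 by (simp add: u_def real_sqrt_mult field_simps)
        finally show ?thesis .
      qed
      finally have Gs: "(\<Sum>j=1..<H. G j) \<le> 40 * d * (real H * u) + (40/3) * (2 * real H / u)"
        using d by simp
      have G0: "(\<Sum>j=1..<H. G j) \<ge> 0" using d \<mu> by (intro sum_nonneg) (auto simp: G_def)
      have "real H * S\<^sup>2 \<le> real (N + H) * (real N + 2 * (\<Sum>j=1..<H. G j))"
        unfolding S_def
      proof (rule weyl_van_der_corput)
        fix j assume j: "0 < j" "j < H"
        show "norm (\<Sum>n<N - j. expi (y / real (D + (n + j)) - y / real (D + n))) \<le> G j"
          using expi_sum_reciprocal_difference[OF assms(1-3) j(1), of \<mu>] unfolding G_def d_def \<mu>_def by simp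
      qed (use 3 in simp)
      also have "\<dots> \<le> (2 * d) * (d + 2 * (40 * d * (real H * u) + (40/3) * (2 * real H / u)))"
        using Gs G0 Nd d 3 by (intro mult_mono add_mono) auto
      finally have "S\<^sup>2 \<le> (2 * d) * (d + 2 * (40 * d * (real H * u) + (40/3) * (2 * real H / u))) / real H"
        using H(3) by (simp add: field_simps)
      also have "\<dots> = 2 * d\<^sup>2 * (1 / real H) + 160 * d\<^sup>2 * u + 320/3 * d * (1 / u)"
        using H(3) u by (simp add: field_simps power2_eq_square)
      also have "\<dots> \<le> 2 * d\<^sup>2 * (2 * r) + 160 * d\<^sup>2 * r + 320/3 * d * (10/7 * (r\<^sup>2 * d / r))"
      proof (intro add_mono mult_left_mono)
        show "1 / real H \<le> 2 * r" using H r(1) by (simp add: field_simps)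
        have "1 / u \<le> 1 / (7/10 * r)" using u2 u r(1) by (intro divide_left_mono) auto
        also have "\<dots> = 10/7 * (1 / r)" by simp
        also have "\<dots> \<le> 10/7 * (r\<^sup>2 * d / r)" using r2d r(1) by (intro mult_left_mono divide_right_mono) auto
        finally show "1 / u \<le> 10/7 * (r\<^sup>2 * d / r)" .
      qed (use u1 d in auto)
      \<comment> \<open>The sum is below 317; rounding it up to the square 324 = 18^2 gives the
        constant of the statement.\<close>
      also have "\<dots> = (164 + 3200/21) * (r * d\<^sup>2)" using r(1) by (simp add: field_simps power2_eq_square)
      also have "\<dots> \<le> 324 * (r * d\<^sup>2)" using r(1) by (intro mult_right_mono) auto
      finally show ?thesis .
    qed
  qed
  have "S \<le> sqrt (324 * (r * d\<^sup>2))" using main by (rule real_le_rsqrt)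
  also have "\<dots> = 18 * sqrt (r * d\<^sup>2)"
  proof -
    have "(324::real) = 18\<^sup>2" by simp
    then show ?thesis by (simp only: real_sqrt_mult real_sqrt_abs abs_numeral)
  qed
  also have "sqrt (r * d\<^sup>2) = (d\<^sup>2 * y) powr (1/6)"
  proof -
    have "(r * d\<^sup>2) ^ 3 = d\<^sup>2 * y"
      using d by (simp only: power_mult_distrib r(2) \<mu>_def) (simp add: power_numeral_reduce)
    then have "(d\<^sup>2 * y) powr (1/6) = ((r * d\<^sup>2) powr 3) powr (1/6)"
      using r(1) d by (simp add: powr_numeral)
    also have "\<dots> = (r * d\<^sup>2) powr (1/2)" by (simp add: powr_powr)
    also have "\<dots> = sqrt (r * d\<^sup>2)" using r(1) by (simp add: powr_half_sqrt)
    finally show ?thesis by simp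
  qed
  finally show ?thesis by (simp add: S_def d_def)
qed

section \<open>The Fourier series of the second Bernoulli function\<close>

text \<open>The Bernoulli polynomial B_2 made 1-periodic. It is continuous across the integers since
  B_2(0) = B_2(1), so its Fourier series can represent it there too.\<close>

definition bern2 :: "real \<Rightarrow> real" where "bern2 u = frac u ^ 2 - frac u + 1/6"

text \<open>The term \<open>n = 0\<close> is a division by zero and hence vanishes; the same convention is used in the Fourier
  series below.\<close>
definition cos_series :: "real \<Rightarrow> real \<Rightarrow> real" where
  "cos_series r t = (\<Sum>n. r ^ n * cos (real n * t) / real n ^ 2)"

lemma summable_inverse_square: "summable (\<lambda>n. 1 / real n ^ 2)"
  using inverse_power_summable[of 2, where 'a = real] by (simp add: field_simps)

lemma norm_cos_series_term_le:
  assumes "0 \<le> r" "r \<le> 1"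
  shows "norm (r ^ n * cos (real n * t) / real n ^ 2) \<le> 1 / real n ^ 2"
proof -
  have "\<bar>r ^ n * cos (real n * t)\<bar> \<le> 1 * 1"
    unfolding abs_mult using assms by (intro mult_mono) (auto simp: power_le_one)
  then show ?thesis by (simp add: divide_right_mono)
qed

lemma summable_cos_series:
  assumes "0 \<le> r" "r \<le> 1"
  shows "summable (\<lambda>n. r ^ n * cos (real n * t) / real n ^ 2)"
  by (rule summable_comparison_test'[OF summable_inverse_square]) (rule norm_cos_series_term_le[OF assms])

text \<open>Closing the strip at r = 1 is the point: it gives the Abel limit for fixed t, and at r =
  1 the extension of the closed formula to the end points t = 0 and t = 2 pi.\<close>

lemma continuous_on_cos_series: "continuous_on ({0..1} \<times> UNIV) (\<lambda>(r, t). cos_series r t)"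
proof -
  have "uniform_limit ({0..1} \<times> UNIV) (\<lambda>N p. \<Sum>n<N. fst p ^ n * cos (real n * snd p) / real n ^ 2)
      (\<lambda>p. \<Sum>n. fst p ^ n * cos (real n * snd p) / real n ^ 2) sequentially"
    by (rule Weierstrass_m_test[OF _ summable_inverse_square], rule norm_cos_series_term_le) auto
  then have "continuous_on ({0..1} \<times> UNIV) (\<lambda>p. \<Sum>n. fst p ^ n * cos (real n * snd p) / real n ^ 2)"
  proof (rule uniform_limit_theorem[rotated])
    show "\<forall>\<^sub>F N in sequentially. continuous_on ({0..1} \<times> UNIV)
        (\<lambda>p. \<Sum>n<N. fst p ^ n * cos (real n * snd p) / real n ^ 2)"
      unfolding divide_inverse by (intro always_eventually allI continuous_intros)
  qed simp
  then show ?thesis by (simp add: cos_series_def case_prod_beta)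
qed

text \<open>The factor r^n makes termwise differentiation legitimate; at r = 1 the differentiated
  series has coefficients of size 1/n and no summable majorant of this kind. For r < 1 it is the
  imaginary part of the logarithmic series at r e^(it).\<close>

lemma cos_series_has_derivative:
  assumes "0 \<le> r" "r < 1"
  shows "(cos_series r has_field_derivative Im (Ln (1 - of_real r * cis t))) (at t)"
proof -
  let ?f = "\<lambda>n t. r ^ n * cos (real n * t) / real n ^ 2"
  let ?f' = "\<lambda>n t. - (r ^ n * sin (real n * t) / real n)"
  have "((\<lambda>t. \<Sum>n. ?f n t) has_field_derivative (\<Sum>n. ?f' n t)) (at t)"
  proof (rule has_field_derivative_series'(2)[of UNIV _ _ 0])
    show "(?f n has_field_derivative ?f' n t) (at t within UNIV)" for n t
      by (cases "n = 0") (auto intro!: derivative_eq_intros simp: power2_eq_square)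
    have "uniform_limit UNIV (\<lambda>N t. \<Sum>n<N. ?f' n t) (\<lambda>t. \<Sum>n. ?f' n t) sequentially"
    proof (rule Weierstrass_m_test)
      show "summable (\<lambda>n. r ^ n)" using assms by (intro summable_geometric) auto
      show "norm (?f' n t) \<le> r ^ n" for n t
      proof (cases "n = 0")
        case False
        have "\<bar>r ^ n * sin (real n * t)\<bar> \<le> r ^ n * real n"
          unfolding abs_mult using assms False order_trans[OF abs_sin_le_one[of "real n * t"], of "real n"]
          by (intro mult_mono) auto
        then show ?thesis using False by (simp add: field_simps)
      qed auto
    qed
    then show "uniformly_convergent_on UNIV (\<lambda>N t. \<Sum>n<N. ?f' n t)"
      by (rule uniformly_convergentI)
    show "summable (\<lambda>n. ?f n 0)" using assms by (intro summable_cos_series) auto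
  qed auto
  moreover have "(\<Sum>n. ?f' n t) = Im (Ln (1 - of_real r * cis t))"
  proof -
    have "cmod (- (of_real r * cis t)) < 1" using assms by (simp add: norm_mult)
    from Ln_series'[OF this] have "(\<lambda>n. - ((of_real r * cis t) ^ n) / of_nat n) sums Ln (1 - of_real r * cis t)"
      by simp
    note ln = sums_Im[OF this]
    have eq: "Im (- ((of_real r * cis t) ^ n) / of_nat n) = ?f' n t" for n
    proof -
      have "- ((of_real r * cis t) ^ n) / of_nat n = of_real (- (r ^ n) / real n) * cis (real n * t)"
        by (simp add: power_mult_distrib Complex.DeMoivre mult.commute)
      then show ?thesis by (simp only: Im_complex_of_real Re_complex_of_real times_complex.sel cis.sel) simp
    qed
    from ln have "(\<lambda>n. ?f' n t) sums Im (Ln (1 - of_real r * cis t))" by (simp only: eq)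
    then show ?thesis by (rule sums_unique[symmetric])
  qed
  ultimately show ?thesis by (simp add: cos_series_def[abs_def])
qed

text \<open>1 - e^(it) = 2 sin(t/2) e^(i(t - pi)/2), where the modulus is positive and the angle
  lies in (-pi/2, pi/2), hence on the principal branch.\<close>

lemma Im_Ln_one_minus_cis:
  assumes "0 < t" "t < 2 * pi"
  shows "Im (Ln (1 - cis t)) = (t - pi) / 2"
proof -
  have "1 - cis t = of_real (2 * sin (t/2)) * cis ((t - pi) / 2)"
  proof -
    have e: "(t - pi) / 2 = t/2 - pi/2" by simp
    have "cis t = cis (t/2) * cis (t/2)" by (simp add: cis_mult)
    moreover have "1 = cis (t/2) * cis (- (t/2))" by (simp add: cis_mult)
    ultimately have "1 - cis t = cis (t/2) * (cis (- (t/2)) - cis (t/2))" by (simp add: algebra_simps)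
    also have "cis (- (t/2)) - cis (t/2) = of_real (2 * sin (t/2)) * cis (- (pi/2))"
      by (simp add: complex_eq_iff)
    also have "cis (t/2) * (of_real (2 * sin (t/2)) * cis (- (pi/2)))
        = of_real (2 * sin (t/2)) * (cis (t/2) * cis (- (pi/2)))"
      by (rule mult.left_commute)
    also have "cis (t/2) * cis (- (pi/2)) = cis ((t - pi) / 2)"
      unfolding cis_mult e by (simp only: diff_conv_add_uminus)
    finally show ?thesis .
  qed
  moreover define s where "s = 2 * sin (t/2)"
  have "s > 0" using assms by (auto simp: s_def intro!: sin_gt_zero)
  then have "Ln (of_real s * cis ((t - pi) / 2)) = of_real (ln s) + Ln (cis ((t - pi) / 2))"
    by (simp add: Ln_times_of_real Ln_of_real)
  moreover have "Ln (cis ((t - pi) / 2)) = \<i> * of_real ((t - pi) / 2)"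
    using assms by (subst Ln_cis) auto
  ultimately show ?thesis by (simp only: flip: s_def) simp
qed

text \<open>Integration of the derivative with r tending to 1, but without integrals. The function
  \<open>Q r\<close> has derivative L(r, t) - L(1, t). On [a, b] the number 1 - r e^(it) has
  positive real part up to r = 1, so \<open>L\<close> is uniformly continuous, this derivative tends
  to 0 uniformly, and the mean value theorem makes \<open>Q 1\<close> constant.\<close>

lemma cos_series_diff:
  assumes "0 < a" "a < b" "b < 2 * pi"
  shows "cos_series 1 b - cos_series 1 a = (b\<^sup>2 / 4 - pi * b / 2) - (a\<^sup>2 / 4 - pi * a / 2)"
proof -
  define L where "L = (\<lambda>(r, t). Im (Ln (1 - of_real r * cis t)))"
  define K where "K = {0..1::real} \<times> {a..b}"
  have cont: "continuous_on K L"
    unfolding L_def case_prod_beta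
  proof (intro continuous_intros)
    show "1 - complex_of_real (fst p) * cis (snd p) \<notin> \<real>\<^sub>\<le>\<^sub>0" if "p \<in> K" for p
    proof -
      have p: "0 \<le> fst p" "fst p \<le> 1" "0 < snd p" "snd p < 2 * pi" using that assms by (auto simp: K_def)
      have "cos (snd p) < 1"
      proof -
        have "sin (snd p / 2) > 0" using p by (intro sin_gt_zero) auto
        moreover have "cos (snd p) = 1 - 2 * sin (snd p / 2) ^ 2"
          using cos_double_sin[of "snd p / 2"] by simp
        ultimately show ?thesis by simp
      qed
      then have "fst p * cos (snd p) < 1"
        using p mult_nonneg_nonpos[of "fst p" "cos (snd p)"] mult_right_mono[of "fst p" 1 "cos (snd p)"]
        by (cases "cos (snd p) \<ge> 0") auto
      then show ?thesis by (auto simp: complex_nonpos_Reals_iff)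
    qed
  qed
  have uc: "uniformly_continuous_on K L"
    using cont by (rule compact_uniformly_continuous) (simp add: K_def compact_Times)
  define Q where "Q r t = cos_series r t - (t\<^sup>2 / 4 - pi * t / 2)" for r t
  have lim: "((\<lambda>r. Q r t) \<longlongrightarrow> Q 1 t) (at_left 1)" for t
  proof -
    have "continuous_on {0..1} ((\<lambda>(r, t). cos_series r t) \<circ> (\<lambda>r. (r, t)))"
      by (intro continuous_on_compose continuous_intros continuous_on_subset[OF continuous_on_cos_series]) auto
    then have "continuous_on {0..1} (\<lambda>r. cos_series r t)" by (simp add: o_def)
    then have "((\<lambda>r. cos_series r t) \<longlongrightarrow> cos_series 1 t) (at 1 within {0..1})"
      by (simp add: continuous_on)
    then have "((\<lambda>r. cos_series r t) \<longlongrightarrow> cos_series 1 t) (at_left 1)"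
      by (simp add: at_within_Icc_at_left)
    then show ?thesis unfolding Q_def by (intro tendsto_intros)
  qed
  have "\<bar>Q 1 b - Q 1 a\<bar> \<le> 0"
  proof (rule field_le_epsilon)
    fix e :: real assume e: "e > 0"
    define e' where "e' = e / (b - a)"
    have "e' > 0" using e assms by (simp add: e'_def)
    then obtain \<delta> where \<delta>: "\<delta> > 0" "\<And>p q. p \<in> K \<Longrightarrow> q \<in> K \<Longrightarrow> dist p q < \<delta> \<Longrightarrow> dist (L p) (L q) < e'"
      using uc unfolding uniformly_continuous_on_def by metis
    have "\<bar>Q r b - Q r a\<bar> \<le> e" if r: "r \<in> {max 0 (1 - \<delta>)<..<1}" for r
    proof -
      have "\<exists>z. a < z \<and> z < b \<and> Q r b - Q r a = (b - a) * (Im (Ln (1 - of_real r * cis z)) - (z - pi) / 2)"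
      proof (rule MVT2[OF assms(2)])
        fix t
        have "((\<lambda>t. cos_series r t - (t\<^sup>2 / 4 - pi * t / 2)) has_real_derivative
            Im (Ln (1 - of_real r * cis t)) - (z - pi) / 2) (at t)" if "z = t" for z
          using r that by (auto intro!: derivative_eq_intros cos_series_has_derivative simp: field_simps)
        then show "(Q r has_real_derivative Im (Ln (1 - of_real r * cis t)) - (t - pi) / 2) (at t)"
          by (simp add: Q_def[abs_def])
      qed
      then obtain z where z: "a < z" "z < b"
        "Q r b - Q r a = (b - a) * (Im (Ln (1 - of_real r * cis z)) - (z - pi) / 2)" by blast
      have "dist (L (r, z)) (L (1, z)) < e'"
        using r z by (intro \<delta>(2)) (auto simp: K_def dist_prod_def dist_real_def)
      moreover have "L (1, z) = (z - pi) / 2"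
        using Im_Ln_one_minus_cis[of z] z assms by (simp add: L_def)
      ultimately have "dist (L (r, z)) ((z - pi) / 2) < e'" by (simp only:)
      then have "\<bar>Im (Ln (1 - of_real r * cis z)) - (z - pi) / 2\<bar> \<le> e'"
        by (simp add: L_def dist_real_def)
      then have "(b - a) * \<bar>Im (Ln (1 - of_real r * cis z)) - (z - pi) / 2\<bar> \<le> (b - a) * e'"
        using assms by (intro mult_left_mono) auto
      then show ?thesis using assms unfolding z(3) abs_mult by (simp add: e'_def)
    qed
    moreover have "\<forall>\<^sub>F r in at_left 1. r \<in> {max 0 (1 - \<delta>)<..<1}"
      using \<delta>(1) by (intro eventually_at_left_real) auto
    ultimately have ev: "\<forall>\<^sub>F r in at_left 1. \<bar>Q r b - Q r a\<bar> \<le> e"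
      by (auto elim: eventually_mono)
    have "((\<lambda>r. \<bar>Q r b - Q r a\<bar>) \<longlongrightarrow> \<bar>Q 1 b - Q 1 a\<bar>) (at_left 1)"
      by (intro tendsto_intros lim)
    from tendsto_upperbound[OF this ev] show "\<bar>Q 1 b - Q 1 a\<bar> \<le> 0 + e" by simp
  qed
  then show ?thesis by (simp add: Q_def)
qed

text \<open>The constant of integration is read off at t = 0 from the value pi^2/6 of the sum of
  inverse squares; continuity links the open interval with its end points.\<close>

lemma cos_series_one:
  assumes "0 \<le> t" "t \<le> 2 * pi"
  shows "cos_series 1 t = pi\<^sup>2 / 6 + t\<^sup>2 / 4 - pi * t / 2"
proof -
  define Q where "Q t = cos_series 1 t - (t\<^sup>2 / 4 - pi * t / 2)" for t
  have const: "Q t = Q pi" if "t \<in> {0<..<2*pi}" for t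
    using cos_series_diff[of t pi] cos_series_diff[of pi t] that
    by (cases t pi rule: linorder_cases) (auto simp: Q_def)
  have "continuous_on UNIV ((\<lambda>(r, t). cos_series r t) \<circ> (\<lambda>t. (1, t)))"
    by (intro continuous_on_compose continuous_intros continuous_on_subset[OF continuous_on_cos_series]) auto
  then have "continuous_on UNIV Q" unfolding Q_def o_def case_prod_conv by (intro continuous_intros) auto
  then have "continuous_on (closure {0<..<2*pi}) Q" by (rule continuous_on_subset) simp
  then have cl: "Q t = Q pi" if "t \<in> closure {0<..<2*pi}" for t
    using const that by (rule continuous_constant_on_closure)
  have "t \<in> closure {0<..<2*pi}" "0 \<in> closure {0<..<2*pi}" using assms by auto
  from this[THEN cl] have "Q t = Q 0" by simp
  moreover have "Q 0 = pi\<^sup>2 / 6"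
  proof -
    have "(\<lambda>n. 1 / real (Suc n) ^ 2) sums (pi\<^sup>2 / 6)"
      using inverse_squares_sums by (simp add: add.commute)
    then have "(\<lambda>n. 1 / real n ^ 2) sums (pi\<^sup>2 / 6)"
      by (subst (asm) sums_Suc_iff) simp
    then show ?thesis by (simp add: Q_def cos_series_def sums_iff)
  qed
  ultimately show ?thesis by (simp add: Q_def)
qed

lemma bern2_sums:
  "(\<lambda>n. cos (2 * pi * (real n * u)) / (pi\<^sup>2 * real n ^ 2)) sums bern2 u"
proof -
  define v where "v = frac u"
  have v: "0 \<le> v" "v < 1" by (auto simp: v_def frac_lt_1)
  have c: "cos (2 * pi * (real n * u)) = cos (real n * (2 * pi * v))" for n
  proof -
    have "2 * pi * (real n * u) = real n * (2 * pi * v) + (2 * pi) * of_int (int n * \<lfloor>u\<rfloor>)"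
      by (simp add: v_def frac_def algebra_simps)
    then show ?thesis by (simp only: cos_add cos_int_2pin sin_int_2pin)
  qed
  have "(\<lambda>n. 1 ^ n * cos (real n * (2 * pi * v)) / real n ^ 2) sums cos_series 1 (2 * pi * v)"
    unfolding cos_series_def by (intro summable_sums summable_cos_series) auto
  from sums_mult[OF this, of "1 / pi\<^sup>2"]
  have "(\<lambda>n. cos (2 * pi * (real n * u)) / (pi\<^sup>2 * real n ^ 2)) sums (1 / pi\<^sup>2 * cos_series 1 (2 * pi * v))"
    by (simp add: c)
  also have "1 / pi\<^sup>2 * cos_series 1 (2 * pi * v) = bern2 u"
    using v by (subst cos_series_one) (auto simp: bern2_def v_def field_simps power2_eq_square)
  finally show ?thesis .
qed

section \<open>Sums of the second Bernoulli function\<close>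

text \<open>The summand is k^(-3/2), which is at most the telescoping difference 2/sqrt(k-1) -
  2/sqrt k for k \<ge> 2.\<close>

lemma sum_sqrt_over_square_le:
  "n > 0 \<Longrightarrow> (\<Sum>k=1..n. sqrt (real k) / real k ^ 2) \<le> 3 - 2 / sqrt (real n)"
proof (induction n rule: nat_induct_non_zero)
  case (Suc n)
  define a b where "a = sqrt (real n)" and "b = sqrt (real (Suc n))"
  have ab: "a > 0" "b > 0" "a \<le> b" "b\<^sup>2 = a\<^sup>2 + 1" using Suc.hyps by (auto simp: a_def b_def)
  have e: "sqrt (real (Suc n)) / real (Suc n) ^ 2 = 1 / b ^ 3"
  proof -
    have "real (Suc n) = b\<^sup>2" by (simp add: b_def)
    then have "real (Suc n) ^ 2 = b * b ^ 3" by (simp add: power_numeral_reduce)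
    then have "sqrt (real (Suc n)) / real (Suc n) ^ 2 = b / (b * b ^ 3)" by (simp only: b_def)
    then show ?thesis using ab(2) by simp
  qed
  have "1 = (b - a) * (b + a)" using ab(4) by (simp add: algebra_simps power2_eq_square)
  then have d: "b - a = 1 / (b + a)" using ab by (simp add: field_simps)
  have "1 / b ^ 3 \<le> 2 / ((b + a) * (a * b))"
  proof -
    have "(b + a) * (a * b) \<le> (2 * b) * (b * b)" using ab by (intro mult_mono) auto
    then have "2 / ((2 * b) * (b * b)) \<le> 2 / ((b + a) * (a * b))" using ab by (intro divide_left_mono) auto
    then show ?thesis by (simp add: power_numeral_reduce)
  qed
  also have "\<dots> = 2 * (b - a) / (a * b)" unfolding d by simp
  also have "\<dots> = 2 / a - 2 / b" using ab by (simp add: field_simps)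
  finally show ?case using Suc.IH e by (simp add: a_def b_def)
qed auto

text \<open>The choice between the tests depends on D alone, not on k: for D \<le> x^(2/5) the third
  derivative test gives (D^2 kx)^(1/6) \<le> k^(1/6) x^(3/10), otherwise the second gives
  (kx/D)^(1/2) \<le> k^(1/2) x^(3/10). The hypotheses on y = kx follow from those on x since k \<ge>
  1.\<close>

lemma expi_sum_reciprocal_le:
  fixes x :: real
  assumes "x > 0" "D > 0" "N \<le> D" "real D ^ 2 \<le> x" "k > 0"
  shows "norm (\<Sum>n<N. expi (real k * x / real (D + n))) \<le> 32 * x powr (3/10) * sqrt (real k)"
proof -
  define y where "y = real k * x"
  have y: "x \<le> y" "y > 0" using assms(1,5) by (auto simp: y_def)
  have D: "real D = (real D ^ 5) powr (1/5)" using assms(2) by (simp add: powr_powr flip: powr_numeral)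
  have x: "(x\<^sup>2) powr (1/5) = x powr (2/5)" using assms(1) by (simp add: powr_powr flip: powr_numeral)
  show ?thesis
  proof (cases "real D ^ 5 \<le> x\<^sup>2")
    case True
    have "real D \<le> x powr (2/5)" unfolding x[symmetric] by (subst D, rule powr_mono2) (use True in auto)
    then have "real D ^ 2 \<le> (x powr (2/5)) ^ 2" by (intro power_mono) auto
    then have "real D ^ 2 * y \<le> (x powr (2/5)) ^ 2 * y" using y by (intro mult_right_mono) auto
    also have "\<dots> = x powr (9/5) * real k"
    proof -
      have "(x powr (2/5)) ^ 2 * x = x powr (2/5) * x powr (2/5) * x powr 1"
        using assms(1) by (simp only: power2_eq_square powr_one)
      also have "\<dots> = x powr (9/5)" by (simp only: powr_add[symmetric]) simp
      finally show ?thesis by (simp add: y_def mult_ac)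
    qed
    finally have "(real D ^ 2 * y) powr (1/6) \<le> (x powr (9/5) * real k) powr (1/6)"
      using y by (intro powr_mono2) auto
    also have "\<dots> = x powr (3/10) * real k powr (1/6)" by (simp add: powr_mult powr_powr)
    also have "\<dots> \<le> x powr (3/10) * real k powr (1/2)"
      using assms(5) by (intro mult_left_mono powr_mono) auto
    also have "real k powr (1/2) = sqrt (real k)" by (simp add: powr_half_sqrt)
    finally have b: "(real D ^ 2 * y) powr (1/6) \<le> x powr (3/10) * sqrt (real k)" .
    have "norm (\<Sum>n<N. expi (y / real (D + n))) \<le> 18 * (real D ^ 2 * y) powr (1/6)"
    proof (rule expi_sum_reciprocal_third)
      show "real D ^ 5 \<le> y\<^sup>2" using True y assms(1) power_mono[of x y 2] by linarith
    qed (use assms y in auto)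
    also have "\<dots> \<le> 32 * (x powr (3/10) * sqrt (real k))" using b by (intro mult_mono) auto
    finally show ?thesis by (simp add: y_def)
  next
    case False
    have "x powr (2/5) \<le> real D" unfolding x[symmetric] by (subst D, rule powr_mono2) (use False assms in auto)
    then have "y / real D \<le> y / x powr (2/5)" using y assms by (intro divide_left_mono) auto
    also have "\<dots> = real k * x powr (3/5)"
    proof -
      have "x = x powr (3/5) * x powr (2/5)" using assms(1) by (simp flip: powr_add)
      then have "x / x powr (2/5) = x powr (3/5)" using assms(1) by (metis nonzero_mult_div_cancel_right powr_eq_0_iff less_irrefl)
      then show ?thesis by (simp add: y_def flip: times_divide_eq_right)
    qed
    finally have "sqrt (y / real D) \<le> sqrt (real k * x powr (3/5))" by simp
    also have "\<dots> = sqrt (real k) * x powr (3/10)"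
      using assms(1) by (simp add: real_sqrt_mult powr_powr flip: powr_half_sqrt)
    finally have b: "sqrt (y / real D) \<le> sqrt (real k) * x powr (3/10)" .
    have "norm (\<Sum>n<N. expi (y / real (D + n))) \<le> 32 * sqrt (y / real D)"
      by (rule expi_sum_reciprocal_second) (use assms y in auto)
    also have "\<dots> \<le> 32 * (sqrt (real k) * x powr (3/10))" using b by simp
    finally show ?thesis by (simp add: y_def mult_ac)
  qed
qed

lemma bern2_block_le:
  fixes x :: real
  assumes "x > 0" "D > 0" "N \<le> D" "real D ^ 2 \<le> x"
  shows "\<bar>\<Sum>n<N. bern2 (x / real (D + n))\<bar> \<le> 96 / pi\<^sup>2 * x powr (3/10)"
proof -
  define c where "c k = (\<Sum>n<N. cos (2 * pi * (real k * (x / real (D + n)))) / (pi\<^sup>2 * real k ^ 2))" for k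
  have "c sums (\<Sum>n<N. bern2 (x / real (D + n)))"
    unfolding c_def by (intro sums_sum bern2_sums)
  then have "(\<lambda>K. \<bar>\<Sum>k<K. c k\<bar>) \<longlonglongrightarrow> \<bar>\<Sum>n<N. bern2 (x / real (D + n))\<bar>"
    unfolding sums_def by (rule tendsto_rabs)
  moreover have "\<bar>\<Sum>k<K. c k\<bar> \<le> 96 / pi\<^sup>2 * x powr (3/10)" for K
  proof -
    have ck: "\<bar>c k\<bar> \<le> 32 / pi\<^sup>2 * x powr (3/10) * (sqrt (real k) / real k ^ 2)" for k
    proof (cases "k = 0")
      case False
      define S where "S = (\<Sum>n<N. expi (real k * x / real (D + n)))"
      have "c k = Re S / (pi\<^sup>2 * real k ^ 2)"
        by (simp add: S_def c_def expi_def sum_divide_distrib)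
      then have "\<bar>c k\<bar> \<le> norm S / (pi\<^sup>2 * real k ^ 2)"
        by (simp add: divide_right_mono abs_Re_le_cmod)
      also have "\<dots> \<le> (32 * x powr (3/10) * sqrt (real k)) / (pi\<^sup>2 * real k ^ 2)"
        using expi_sum_reciprocal_le[OF assms, of k] False unfolding S_def by (intro divide_right_mono) auto
      finally show ?thesis by simp
    qed (simp add: c_def)
    have "\<bar>\<Sum>k<K. c k\<bar> \<le> (\<Sum>k<K. \<bar>c k\<bar>)" by (rule sum_abs)
    also have "\<dots> \<le> (\<Sum>k<K. 32 / pi\<^sup>2 * x powr (3/10) * (sqrt (real k) / real k ^ 2))"
      by (intro sum_mono ck)
    also have "\<dots> = 32 / pi\<^sup>2 * x powr (3/10) * (\<Sum>k<K. sqrt (real k) / real k ^ 2)"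
      by (simp add: sum_distrib_left)
    also have "\<dots> \<le> 32 / pi\<^sup>2 * x powr (3/10) * 3"
    proof (rule mult_left_mono)
      \<comment> \<open>Going up to \<open>Suc K\<close> guarantees a nonempty range for the bound
        on the sum; the term k = 0 is zero by division by zero.\<close>
      have "(\<Sum>k<K. sqrt (real k) / real k ^ 2) \<le> (\<Sum>k\<in>{0..Suc K}. sqrt (real k) / real k ^ 2)"
        by (intro sum_mono2) auto
      also have "\<dots> = (\<Sum>k=1..Suc K. sqrt (real k) / real k ^ 2)"
        by (subst sum.atLeast_Suc_atMost) auto
      also have "\<dots> \<le> 3 - 2 / sqrt (real (Suc K))" by (rule sum_sqrt_over_square_le) simp
      also have "\<dots> \<le> 3" by simp
      finally show "(\<Sum>k<K. sqrt (real k) / real k ^ 2) \<le> 3" .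
    qed simp
    finally show ?thesis by simp
  qed
  ultimately show ?thesis by (intro tendsto_upperbound[of _ _ sequentially]) auto
qed

text \<open>Halving: with K = M div 2 the indices above K form one block of at most K + 1 terms
  starting at K + 1, at the cost of a single constant, while the binary logarithm of what remains
  has dropped by at least 1.\<close>

lemma bern2_sum_le:
  fixes x :: real
  assumes "M > 0" "real M ^ 2 \<le> x"
  shows "\<bar>\<Sum>m=1..M. bern2 (x / real m)\<bar> \<le> 96 / pi\<^sup>2 * x powr (3/10) * (1 + log 2 (real M))"
  using assms
proof (induction M rule: less_induct)
  case (less M)
  define C where "C = 96 / pi\<^sup>2 * x powr (3/10)"
  have C: "C \<ge> 0" by (simp add: C_def)
  define K where "K = M div 2"
  have K: "K < M" "M - K \<le> K + 1" using less.prems by (auto simp: K_def)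
  have "x > 0" using less.prems by (meson less_le_trans of_nat_0_less_iff zero_less_power)
  have "{1..M} = {1..K} \<union> {K+1..M}" "{1..K} \<inter> {K+1..M} = {}" using K by auto
  then have "(\<Sum>m=1..M. bern2 (x / real m)) = (\<Sum>m=1..K. bern2 (x / real m)) + (\<Sum>m=K+1..M. bern2 (x / real m))"
    by (simp add: sum.union_disjoint)
  also have "(\<Sum>m=K+1..M. bern2 (x / real m)) = (\<Sum>n<M-K. bern2 (x / real (K + 1 + n)))"
    by (rule sum.reindex_bij_witness[where i = "\<lambda>n. K + 1 + n" and j = "\<lambda>m. m - (K + 1)"]) auto
  finally have "\<bar>\<Sum>m=1..M. bern2 (x / real m)\<bar>
      \<le> \<bar>\<Sum>m=1..K. bern2 (x / real m)\<bar> + \<bar>\<Sum>n<M-K. bern2 (x / real (K + 1 + n))\<bar>"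
    by simp
  also have "\<bar>\<Sum>n<M-K. bern2 (x / real (K + 1 + n))\<bar> \<le> C"
    unfolding C_def
  proof (rule bern2_block_le)
    have "real (K + 1) ^ 2 \<le> real M ^ 2" using K by (intro power_mono) auto
    then show "real (K + 1) ^ 2 \<le> x" using less.prems by linarith
  qed (use K \<open>x > 0\<close> in auto)
  also have "\<bar>\<Sum>m=1..K. bern2 (x / real m)\<bar> + C \<le> C * (1 + log 2 (real M))"
  proof (cases "K = 0")
    case True
    then show ?thesis using less.prems C by (simp add: mult_le_cancel_left1)
  next
    case False
    have "real K ^ 2 \<le> real M ^ 2" using K by (intro power_mono) auto
    then have "real K ^ 2 \<le> x" using less.prems by linarith
    then have "\<bar>\<Sum>m=1..K. bern2 (x / real m)\<bar> \<le> C * (1 + log 2 (real K))"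
      unfolding C_def using less.IH[OF K(1)] False by blast
    also have "\<dots> \<le> C * log 2 (real M)"
    proof (rule mult_left_mono[OF _ C])
      have "log 2 (real K) \<le> log 2 (real M / 2)"
        using False less.prems unfolding K_def by (subst log_le_cancel_iff) auto
      also have "\<dots> = log 2 (real M) - 1" using less.prems by (simp add: log_divide)
      finally show "1 + log 2 (real K) \<le> log 2 (real M)" by simp
    qed
    finally show ?thesis by (simp add: algebra_simps)
  qed
  finally show ?case by (simp add: C_def)
qed

section \<open>Euler--Maclaurin expansions\<close>

text \<open>Replaces remainder integrals in Euler--Maclaurin: an error bound \<open>b\<close> need
  only be verified for one step from k to k + 1, which is an elementary inequality in t =
  1/k.\<close>

lemma limit_error_telescope:
  fixes a b :: "nat \<Rightarrow> real"
  assumes step: "\<And>k. k \<ge> n \<Longrightarrow> \<bar>a k - a (Suc k)\<bar> \<le> b k - b (Suc k)"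
    and lim: "a \<longlonglongrightarrow> l" "b \<longlonglongrightarrow> 0"
  shows "\<bar>a n - l\<bar> \<le> b n"
proof -
  have "\<bar>a n - a m\<bar> \<le> b n - b m" if "m \<ge> n" for m
    using that
  proof (induction m rule: dec_induct)
    case (step m)
    then show ?case using assms(1)[of m] by linarith
  qed auto
  then have "\<forall>\<^sub>F m in sequentially. \<bar>a n - a m\<bar> \<le> b n - b m"
    using eventually_sequentially by blast
  moreover have "(\<lambda>m. \<bar>a n - a m\<bar>) \<longlonglongrightarrow> \<bar>a n - l\<bar>" "(\<lambda>m. b n - b m) \<longlonglongrightarrow> b n - 0"
    by (intro tendsto_intros lim)+
  ultimately show ?thesis using tendsto_le[of sequentially] by force
qed

text \<open>The two differences have derivatives s^3/(1+s) and s^4/(1+s), the remainders of the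
  geometric series for 1/(1+s).\<close>

lemma ln_one_plus_cubic:
  fixes t :: real
  assumes "t \<ge> 0"
  shows "ln (1 + t) \<le> t - t\<^sup>2 / 2 + t ^ 3 / 3" "t - t\<^sup>2 / 2 + t ^ 3 / 3 - t ^ 4 / 4 \<le> ln (1 + t)"
proof -
  have "t - t\<^sup>2 / 2 + t ^ 3 / 3 - ln (1 + t) \<ge> 0 - 0\<^sup>2 / 2 + 0 ^ 3 / 3 - ln (1 + 0)"
  proof (rule DERIV_nonneg_imp_nondecreasing[OF assms])
    fix s :: real assume "0 \<le> s" "s \<le> t"
    then show "\<exists>y. ((\<lambda>t. t - t\<^sup>2 / 2 + t ^ 3 / 3 - ln (1 + t)) has_real_derivative y) (at s) \<and> 0 \<le> y"
      by (intro exI[of _ "s ^ 3 / (1 + s)"])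
        (auto intro!: derivative_eq_intros simp: field_simps power_numeral_reduce)
  qed
  then show "ln (1 + t) \<le> t - t\<^sup>2 / 2 + t ^ 3 / 3" by simp
  have "ln (1 + t) - (t - t\<^sup>2 / 2 + t ^ 3 / 3 - t ^ 4 / 4) \<ge> ln (1 + 0) - (0 - 0\<^sup>2 / 2 + 0 ^ 3 / 3 - 0 ^ 4 / 4)"
  proof (rule DERIV_nonneg_imp_nondecreasing[OF assms])
    fix s :: real assume "0 \<le> s" "s \<le> t"
    then show "\<exists>y. ((\<lambda>t. ln (1 + t) - (t - t\<^sup>2 / 2 + t ^ 3 / 3 - t ^ 4 / 4)) has_real_derivative y) (at s) \<and> 0 \<le> y"
      by (intro exI[of _ "s ^ 4 / (1 + s)"])
        (auto intro!: derivative_eq_intros simp: field_simps power_numeral_reduce)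
  qed
  then show "t - t\<^sup>2 / 2 + t ^ 3 / 3 - t ^ 4 / 4 \<le> ln (1 + t)" by simp
qed

lemma ln_one_plus_quadratic:
  fixes t :: real
  assumes "t \<ge> 0"
  shows "\<bar>ln (1 + t) - (t - t\<^sup>2 / 2)\<bar> \<le> t ^ 3 / 3"
proof -
  have "ln (1 + t) - (t - t\<^sup>2 / 2) \<ge> ln (1 + 0) - (0 - 0\<^sup>2 / 2)"
  proof (rule DERIV_nonneg_imp_nondecreasing[OF assms])
    fix s :: real assume "0 \<le> s" "s \<le> t"
    then show "\<exists>y. ((\<lambda>t. ln (1 + t) - (t - t\<^sup>2 / 2)) has_real_derivative y) (at s) \<and> 0 \<le> y"
      by (intro exI[of _ "s ^ 2 / (1 + s)"])
        (auto intro!: derivative_eq_intros simp: field_simps power_numeral_reduce)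
  qed
  then show ?thesis using ln_one_plus_cubic(1)[OF assms] by simp
qed

lemma ln_Suc_conv:
  assumes "n > 0"
  shows "ln (real (Suc n)) = ln (real n) + ln (1 + 1 / real n)"
proof -
  have "real (Suc n) = real n * (1 + 1 / real n)" using assms by (simp add: field_simps)
  moreover have "1 + 1 / real n > 0" by (simp add: add_pos_nonneg)
  ultimately show ?thesis using assms ln_mult[of "real n" "1 + 1 / real n"] by auto
qed

lemma inverse_Suc_conv:
  assumes "n > 0"
  shows "1 / real (Suc n) = (1 / real n) / (1 + 1 / real n)"
  using assms by (simp add: field_simps)

lemma harm_expansion:
  assumes "n > 0"
  shows "\<bar>harm n - ln (real n) - 1 / (2 * real n) + 1 / (12 * real n ^ 2) - euler_mascheroni\<bar> \<le> 1 / real n ^ 3"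
proof -
  define a where "a n = harm n - ln (real n) - 1/2 * (1 / real n) + 1/12 * (1 / real n)^2" for n
  have "\<bar>a n - euler_mascheroni\<bar> \<le> (1 / real n) ^ 3"
  proof (rule limit_error_telescope[where a = a and b = "\<lambda>k. (1 / real k) ^ 3"])
    fix k assume "k \<ge> n"
    define t where "t = 1 / real k"
    have k: "k > 0" using \<open>k \<ge> n\<close> assms by simp
    then have t: "0 < t" "t \<le> 1" by (auto simp: t_def)
    define s where "s = 1 / real (Suc k)"
    have s: "s = t / (1 + t)" unfolding s_def t_def by (rule inverse_Suc_conv[OF k])
    have "a k - a (Suc k) = ln (1 + t) - s / 2 - t / 2 + t\<^sup>2 / 12 - s\<^sup>2 / 12"
      unfolding a_def harm_Suc ln_Suc_conv[OF k] inverse_eq_divide t_def[symmetric] s_def[symmetric]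
      by (simp add: algebra_simps)
    note ak = this[unfolded s]
    \<comment> \<open>\<open>R\<close> is the step with the logarithm replaced by its cubic upper
      bound. All terms through t^3 cancel, so 0 \<le> R \<le> t^4/4, and the lower bound for the
      logarithm is smaller by t^4/4 only.\<close>
    define R where "R = t - t\<^sup>2 / 2 + t ^ 3 / 3 - (t / (1 + t)) / 2 - t / 2 + t\<^sup>2 / 12 - (t / (1 + t))\<^sup>2 / 12"
    have R: "R = t ^ 4 * ((3 + 4 * t) / (12 * (1 + t)\<^sup>2))"
      using t unfolding R_def by (simp add: divide_simps) algebra
    have "(3 + 4 * t) / (12 * (1 + t)\<^sup>2) \<le> 1/4" using t by (simp add: divide_simps power2_eq_square algebra_simps)
    then have "R \<le> t ^ 4 * (1/4)" unfolding R by (intro mult_left_mono) auto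
    moreover have "R \<ge> 0" unfolding R using t by simp
    ultimately have "\<bar>a k - a (Suc k)\<bar> \<le> t ^ 4 / 4"
      using ln_one_plus_cubic[of t] t unfolding ak R_def abs_le_iff by linarith
    also have "\<dots> \<le> t ^ 3 - (t / (1 + t)) ^ 3"
    proof -
      have "t ^ 3 - (t / (1 + t)) ^ 3 - t ^ 4 / 4 = t ^ 4 * (11 + 9 * t + t\<^sup>2 - t ^ 3) / (4 * (1 + t) ^ 3)"
        using t by (simp add: divide_simps) algebra
      moreover have "t ^ 3 \<le> 1" using t by (intro power_le_one) auto
      then have "11 + 9 * t + t\<^sup>2 - t ^ 3 \<ge> 0" using t zero_le_power2[of t] by linarith
      then have "t ^ 4 * (11 + 9 * t + t\<^sup>2 - t ^ 3) / (4 * (1 + t) ^ 3) \<ge> 0" using t by auto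
      ultimately show ?thesis by linarith
    qed
    finally show "\<bar>a k - a (Suc k)\<bar> \<le> (1 / real k) ^ 3 - (1 / real (Suc k)) ^ 3"
      by (simp only: t_def inverse_Suc_conv[OF k])
  next
    have "a \<longlonglongrightarrow> euler_mascheroni - 1/2 * 0 + 1/12 * 0^2"
      unfolding a_def by (intro tendsto_intros euler_mascheroni_LIMSEQ lim_inverse_n')
    then show "a \<longlonglongrightarrow> euler_mascheroni" by simp
    have "(\<lambda>n. (1 / real n) ^ 3) \<longlonglongrightarrow> 0 ^ 3" by (intro tendsto_intros lim_inverse_n')
    then show "(\<lambda>n. (1 / real n) ^ 3) \<longlonglongrightarrow> 0" by simp
  qed
  then show ?thesis by (simp add: a_def power_divide)
qed

lemma inverse_squares_expansion:
  assumes "n > 0"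
  shows "\<bar>(\<Sum>k=1..n. 1 / real k ^ 2) + 1 / real n - 1 / (2 * real n ^ 2) + 1 / (6 * real n ^ 3) - pi\<^sup>2 / 6\<bar> \<le> 1 / real n ^ 4"
proof -
  define a where "a n = (\<Sum>k=1..n. (1 / real k) ^ 2) + 1 / real n - 1/2 * (1 / real n)^2 + 1/6 * (1 / real n)^3" for n
  have "\<bar>a n - pi\<^sup>2 / 6\<bar> \<le> (1 / real n) ^ 4"
  proof (rule limit_error_telescope[where a = a and b = "\<lambda>k. (1 / real k) ^ 4"])
    fix k assume "k \<ge> n"
    define t where "t = 1 / real k"
    have k: "k > 0" using \<open>k \<ge> n\<close> assms by simp
    then have t: "0 < t" "t \<le> 1" by (auto simp: t_def)
    define s where "s = 1 / real (Suc k)"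
    have sm: "(\<Sum>k=1..Suc k. (1 / real k) ^ 2) = (\<Sum>k=1..k. (1 / real k) ^ 2) + (1 / real (Suc k)) ^ 2" by simp
    have "a k - a (Suc k) = t - s - s\<^sup>2 - t\<^sup>2 / 2 + s\<^sup>2 / 2 + t ^ 3 / 6 - s ^ 3 / 6"
      unfolding a_def sm t_def[symmetric] s_def[symmetric] by (simp add: algebra_simps)
    moreover have "s = t / (1 + t)" unfolding s_def t_def by (rule inverse_Suc_conv[OF k])
    ultimately have ak: "a k - a (Suc k) = t - (t / (1 + t)) - (t / (1 + t))\<^sup>2 - t\<^sup>2 / 2 + (t / (1 + t))\<^sup>2 / 2 + t ^ 3 / 6 - (t / (1 + t)) ^ 3 / 6"
      by simp
    have "a k - a (Suc k) = t ^ 6 / (6 * (1 + t) ^ 3)"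
      using t unfolding ak by (simp add: divide_simps power_numeral_reduce) algebra
    also have "\<bar>\<dots>\<bar> \<le> t ^ 4 - (t / (1 + t)) ^ 4"
    proof -
      have "t ^ 4 - (t / (1 + t)) ^ 4 - t ^ 6 / (6 * (1 + t) ^ 3) = t ^ 5 * (24 + 35 * t + 23 * t\<^sup>2 + 6 * t ^ 3) / (6 * (1 + t) ^ 4)"
        using t by (simp add: divide_simps) algebra
      moreover have "t ^ 5 * (24 + 35 * t + 23 * t\<^sup>2 + 6 * t ^ 3) / (6 * (1 + t) ^ 4) \<ge> 0" using t by auto
      moreover have "t ^ 6 / (6 * (1 + t) ^ 3) \<ge> 0" using t by auto
      ultimately show ?thesis by linarith
    qed
    finally show "\<bar>a k - a (Suc k)\<bar> \<le> (1 / real k) ^ 4 - (1 / real (Suc k)) ^ 4"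
      by (simp only: t_def inverse_Suc_conv[OF k])
  next
    have "(\<lambda>n. 1 / real (Suc n) ^ 2) sums (pi\<^sup>2 / 6)"
      using inverse_squares_sums by (simp add: add.commute)
    then have "(\<lambda>n. \<Sum>k<n. 1 / real (Suc k) ^ 2) \<longlonglongrightarrow> pi\<^sup>2 / 6" by (simp add: sums_def)
    moreover have "(\<Sum>k<n. 1 / real (Suc k) ^ 2) = (\<Sum>k=1..n. (1 / real k) ^ 2)" for n
      by (rule sum.reindex_bij_witness[where i = "\<lambda>k. k - 1" and j = Suc]) (auto simp: power_divide)
    ultimately have "(\<lambda>n. \<Sum>k=1..n. (1 / real k) ^ 2) \<longlonglongrightarrow> pi\<^sup>2 / 6" by simp
    then have "a \<longlonglongrightarrow> pi\<^sup>2 / 6 + 0 - 1/2 * 0^2 + 1/6 * 0^3"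
      unfolding a_def by (intro tendsto_intros lim_inverse_n')
    then show "a \<longlonglongrightarrow> pi\<^sup>2 / 6" by simp
    have "(\<lambda>n. (1 / real n) ^ 4) \<longlonglongrightarrow> 0 ^ 4" by (intro tendsto_intros lim_inverse_n')
    then show "(\<lambda>n. (1 / real n) ^ 4) \<longlonglongrightarrow> 0" by simp
  qed
  then show ?thesis by (simp add: a_def power_divide)
qed

section \<open>Stirling's formula with an explicit error\<close>

lemma convergent_telescope:
  fixes a b :: "nat \<Rightarrow> real"
  assumes step: "\<And>k. k > 0 \<Longrightarrow> \<bar>a k - a (Suc k)\<bar> \<le> b k - b (Suc k)" and lim: "b \<longlonglongrightarrow> 0"
  shows "convergent a"
proof -
  have "summable (\<lambda>k. b (Suc k) - b (Suc (Suc k)))"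
    using telescope_summable'[OF LIMSEQ_Suc[OF lim]] by simp
  then have "summable (\<lambda>k. a (Suc (Suc k)) - a (Suc k))"
    by (rule summable_comparison_test') (use step in \<open>simp add: abs_minus_commute\<close>)
  then have "convergent (\<lambda>n. \<Sum>k<n. a (Suc (Suc k)) - a (Suc k))"
    by (simp add: summable_iff_convergent)
  moreover have "(\<lambda>n. \<Sum>k<n. a (Suc (Suc k)) - a (Suc k)) = (\<lambda>n. a (Suc n) - a (Suc 0))"
    using sum_lessThan_telescope[of "\<lambda>k. a (Suc k)"] by auto
  ultimately have "convergent (\<lambda>n. a (Suc n) - a (Suc 0))" by simp
  then have "convergent (\<lambda>n. (a (Suc n) - a (Suc 0)) + a (Suc 0))" by (intro convergent_add convergent_const)
  then show ?thesis by (simp add: convergent_Suc_iff)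
qed

text \<open>In terms of factorials the Wallis product can be compared with the Stirling sequence at
  n and 2n, which identifies its limit.\<close>

lemma wallis_product_eq:
  "(\<Prod>k=1..n. (4 * real k ^ 2) / (4 * real k ^ 2 - 1)) = 16 ^ n * fact n ^ 4 / (fact (2 * n) ^ 2 * (2 * real n + 1))"
proof (induction n)
  case (Suc n)
  have "(fact (2 * Suc n) :: real) = (2 * real n + 2) * ((2 * real n + 1) * fact (2 * n))"
    by (simp add: algebra_simps)
  moreover have "4 * real (Suc n) ^ 2 - 1 = (2 * real n + 1) * (2 * real n + 3)"
    by (simp add: power2_eq_square algebra_simps)
  moreover have "2 * real n + 1 \<noteq> 0" "2 * real n + 3 \<noteq> 0" "2 * real n + 2 \<noteq> 0" "(fact (2 * n) :: real) \<noteq> 0" by auto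
  moreover have "(fact (Suc n) :: real) = (real n + 1) * fact n" "real (Suc n) = real n + 1" by (auto simp: algebra_simps)
  moreover have "2 * real (Suc n) + 1 = 2 * real n + 3" by simp
  ultimately show ?case
    unfolding prod.cl_ivl_Suc Suc.IH
    by (simp add: divide_simps) (simp add: power_numeral_reduce algebra_simps)
qed auto

lemma ln_fact_step:
  assumes "k > 0"
  shows "\<bar>(ln (fact k) - (real k + 1/2) * ln (real k) + real k - 1/12 * (1 / real k))
     - (ln (fact (Suc k)) - (real (Suc k) + 1/2) * ln (real (Suc k)) + real (Suc k) - 1/12 * (1 / real (Suc k)))\<bar>
    \<le> (1 / real k) ^ 2 - (1 / real (Suc k)) ^ 2" (is "\<bar>?d\<bar> \<le> _")
proof -
  define t where "t = 1 / real k"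
  define s where "s = 1 / real (Suc k)"
  have t: "0 < t" "t \<le> 1" using assms by (auto simp: t_def)
  have s: "s = t / (1 + t)" unfolding s_def t_def by (rule inverse_Suc_conv[OF assms])
  have kt: "real k = 1 / t" using assms by (simp add: t_def)
  have lf: "ln (fact (Suc k) :: real) = ln (real (Suc k)) + ln (fact k)"
    unfolding fact_Suc by (subst ln_mult) (auto simp del: of_nat_Suc)
  have "?d = (real k + 1/2) * ln (1 + t) - 1 - 1/12 * t + 1/12 * s"
    unfolding lf ln_Suc_conv[OF assms] t_def[symmetric] s_def[symmetric] by (simp add: algebra_simps)
  then have d: "?d = (1 / t + 1/2) * ln (1 + t) - 1 - 1/12 * t + 1/12 * s" by (simp only: kt)
  define R where "R = (1 / t + 1/2) * (t - t\<^sup>2 / 2 + t ^ 3 / 3) - 1 - 1/12 * t + 1/12 * s"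
  have R: "R = t ^ 3 * ((3 + 2 * t) / (12 * (1 + t)))"
    using t unfolding R_def s by (simp add: divide_simps) algebra
  have "(3 + 2 * t) / (12 * (1 + t)) \<le> 1/4" using t by (simp add: divide_simps)
  then have "R \<le> t ^ 3 * (1/4)" unfolding R using t by (intro mult_left_mono) auto
  moreover have "R \<ge> 0" unfolding R using t by simp
  \<comment> \<open>The factor 1/t + 1/2 costs one power of t: the logarithm's error t^4/4 becomes
    t^3/4 + t^4/8, hence at most 3t^3/8.\<close>
  moreover have "(1 / t + 1/2) * ln (1 + t) \<le> (1 / t + 1/2) * (t - t\<^sup>2 / 2 + t ^ 3 / 3)"
    using ln_one_plus_cubic[of t] t by (intro mult_left_mono) auto
  moreover have "(1 / t + 1/2) * (t - t\<^sup>2 / 2 + t ^ 3 / 3 - t ^ 4 / 4) \<le> (1 / t + 1/2) * ln (1 + t)"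
    using ln_one_plus_cubic[of t] t by (intro mult_left_mono) auto
  moreover have "(1 / t + 1/2) * (t - t\<^sup>2 / 2 + t ^ 3 / 3 - t ^ 4 / 4)
      = (1 / t + 1/2) * (t - t\<^sup>2 / 2 + t ^ 3 / 3) - (t ^ 3 / 4 + t ^ 4 / 8)"
    using t by (simp add: field_simps power_numeral_reduce)
  moreover have "t ^ 4 \<le> t ^ 3" using t by (intro power_decreasing) auto
  ultimately have "\<bar>?d\<bar> \<le> 3/8 * t ^ 3" unfolding d R_def abs_le_iff by linarith
  also have "\<dots> \<le> t\<^sup>2 - s\<^sup>2"
  proof -
    have "t\<^sup>2 - s\<^sup>2 - 3/8 * t ^ 3 = t ^ 3 * (13 + 2 * t - 3 * t\<^sup>2) / (8 * (1 + t)\<^sup>2)"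
      using t unfolding s by (simp add: divide_simps) algebra
    moreover have "t\<^sup>2 \<le> 1" using t by (intro power_le_one) auto
    then have "t ^ 3 * (13 + 2 * t - 3 * t\<^sup>2) / (8 * (1 + t)\<^sup>2) \<ge> 0" using t by auto
    ultimately show ?thesis by linarith
  qed
  finally show ?thesis by (simp only: t_def s_def)
qed

lemma ln_fact_expansion:
  assumes "n > 0"
  shows "\<bar>ln (fact n) - (real n + 1/2) * ln (real n) + real n - 1 / (12 * real n) - ln (2 * pi) / 2\<bar> \<le> 1 / real n ^ 2"
proof -
  define a where "a n = ln (fact n) - (real n + 1/2) * ln (real n) + real n - 1/12 * (1 / real n)" for n
  have step: "\<bar>a k - a (Suc k)\<bar> \<le> (1 / real k) ^ 2 - (1 / real (Suc k)) ^ 2" if "k > 0" for k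
    unfolding a_def by (rule ln_fact_step[OF that])
  have "(\<lambda>n. (1 / real n) ^ 2) \<longlonglongrightarrow> 0 ^ 2" by (intro tendsto_intros lim_inverse_n')
  then have b0: "(\<lambda>n. (1 / real n) ^ 2) \<longlonglongrightarrow> 0" by simp
  \<comment> \<open>Here the limit is not known beforehand, so convergence comes first. Steps start
    at k = 1, because 1/0 = 0 spoils the bound at k = 0.\<close>
  obtain c where c: "a \<longlonglongrightarrow> c"
    using convergent_telescope[OF step b0] by (auto simp: convergent_def)
  \<comment> \<open>The logarithm of the Wallis product is 4 \<open>a n\<close> - 2
    \<open>a (2 * n)\<close> up to explicit terms. It tends to 2c - 2 log 2 and also to log(pi/2),
    so c = log(2 pi)/2.\<close>
  have lim: "(\<lambda>n. 4 * (a n + 1/12 * (1 / real n)) - 2 * (a (2 * n) + 1/12 * (1 / real (2 * n))) - ln 2 - ln (2 + 1 / real n))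
      \<longlonglongrightarrow> 4 * (c + 1/12 * 0) - 2 * (c + 1/12 * 0) - ln 2 - ln (2 + 0)"
  proof -
    have e: "strict_mono (\<lambda>n::nat. 2 * n)" by (auto simp: strict_mono_def)
    have "(\<lambda>n. a (2 * n)) \<longlonglongrightarrow> c" "(\<lambda>n. 1 / real (2 * n)) \<longlonglongrightarrow> 0"
      using LIMSEQ_subseq_LIMSEQ[OF c e] LIMSEQ_subseq_LIMSEQ[OF lim_inverse_n' e] by (simp_all add: o_def)
    then show ?thesis by (intro tendsto_intros c lim_inverse_n') auto
  qed
  have w: "ln (16 ^ n * fact n ^ 4 / (fact (2 * n) ^ 2 * (2 * real n + 1)))
      = 4 * (a n + 1/12 * (1 / real n)) - 2 * (a (2 * n) + 1/12 * (1 / real (2 * n))) - ln 2 - ln (2 + 1 / real n)"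
    if "n > 0" for n
  proof -
    have "ln (16::real) = 4 * ln 2" using ln_realpow[of "2::real" 4] by simp
    moreover have "2 * real n + 1 = real n * (2 + 1 / real n)" using that by (simp add: field_simps)
    then have "ln (2 * real n + 1) = ln (real n) + ln (2 + 1 / real n)"
      using that ln_mult[of "real n" "2 + 1 / real n"] add_pos_nonneg[of 2 "1 / real n"] by simp
    moreover have "ln (16 ^ n * fact n ^ 4 / (fact (2 * n) ^ 2 * (2 * real n + 1)))
        = real n * ln 16 + 4 * ln (fact n) - 2 * ln (fact (2 * n)) - ln (2 * real n + 1)"
      by (simp add: ln_div ln_mult ln_realpow)
    moreover have "ln (real (2 * n)) = ln 2 + ln (real n)" using that by (simp add: ln_mult)
    ultimately show ?thesis using that by (simp add: a_def algebra_simps)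
  qed
  have "(\<lambda>n. ln (\<Prod>k=1..n. (4 * real k ^ 2) / (4 * real k ^ 2 - 1))) \<longlonglongrightarrow> ln (pi / 2)"
    by (intro tendsto_ln wallis) simp
  then have "(\<lambda>n. 4 * (a n + 1/12 * (1 / real n)) - 2 * (a (2 * n) + 1/12 * (1 / real (2 * n))) - ln 2 - ln (2 + 1 / real n))
      \<longlonglongrightarrow> ln (pi / 2)"
    unfolding wallis_product_eq
    by (rule Lim_transform_eventually) (rule eventually_mono[OF eventually_gt_at_top[of 0]], rule w)
  from LIMSEQ_unique[OF this lim] have "ln (pi / 2) = 2 * c - 2 * ln 2" by simp
  then have "c = ln (2 * pi) / 2" by (simp add: ln_mult ln_div)
  have "\<bar>a n - c\<bar> \<le> (1 / real n) ^ 2"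
    by (rule limit_error_telescope[where a = a and b = "\<lambda>k. (1 / real k) ^ 2"]) (use step assms b0 c in auto)
  then show ?thesis by (simp add: a_def power_divide \<open>c = _\<close>)
qed

section \<open>The harmonic sum up to a real end point\<close>

lemma abs_bern2_le: "\<bar>bern2 u\<bar> \<le> 1/6"
proof -
  have f: "0 \<le> frac u" "frac u < 1" by (auto simp: frac_lt_1)
  have "frac u * (1 - frac u) \<ge> 0" using f by (intro mult_nonneg_nonneg) auto
  moreover have "(frac u - 1/2)\<^sup>2 \<ge> 0" by simp
  ultimately show ?thesis unfolding bern2_def power2_eq_square abs_le_iff by (simp add: algebra_simps)
qed

text \<open>Expanding ln z, 1/z and 1/z^2 around N = z - {z} turns the expansion at z into the one
  at N; the terms through N^(-2) agree exactly (\<open>eq\<close>).\<close>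

lemma harm_floor_expansion:
  fixes z :: real
  assumes "real N \<le> z" "z < real N + 1" "N > 0"
  shows "\<bar>harm N - (ln z + euler_mascheroni + (1/2 - frac z) / z - bern2 z / (2 * z\<^sup>2))\<bar> \<le> 2 / real N ^ 3"
proof -
  define f where "f = frac z"
  define n where "n = real N"
  have n: "n \<ge> 1" "n > 0" using assms(3) by (auto simp: n_def)
  have "\<lfloor>z\<rfloor> = int N" using assms by (intro floor_unique) auto
  then have z: "z = n + f" by (simp add: f_def n_def frac_def)
  have f: "0 \<le> f" "f < 1" by (auto simp: f_def frac_lt_1)
  define t where "t = f / n"
  have t: "0 \<le> t" using f n by (simp add: t_def)
  have zt: "z = n * (1 + t)" using n by (simp add: z t_def field_simps)
  have l: "\<bar>ln z - (ln n + f / n - f\<^sup>2 / (2 * n\<^sup>2))\<bar> \<le> 1 / (3 * n ^ 3)"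
  proof -
    have "ln z = ln n + ln (1 + t)" using n t unfolding zt by (simp add: ln_mult)
    then have "ln z - (ln n + f / n - f\<^sup>2 / (2 * n\<^sup>2)) = ln (1 + t) - (t - t\<^sup>2 / 2)"
      by (simp add: t_def power_divide)
    also have "\<bar>\<dots>\<bar> \<le> t ^ 3 / 3" by (rule ln_one_plus_quadratic[OF t])
    also have "t ^ 3 \<le> (1 / n) ^ 3" using f n t unfolding t_def by (intro power_mono divide_right_mono) auto
    finally show ?thesis by (simp add: power_divide)
  qed
  have i1: "\<bar>1 / z - (1 / n - f / n\<^sup>2)\<bar> \<le> 1 / n ^ 3"
  proof -
    have "1 / z - (1 / n - f / n\<^sup>2) = f\<^sup>2 / (n\<^sup>2 * (n + f))"
      using n f unfolding z by (simp add: divide_simps) algebra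
    moreover have "0 \<le> f\<^sup>2 / (n\<^sup>2 * (n + f))" using n f by simp
    moreover have "f\<^sup>2 / (n\<^sup>2 * (n + f)) \<le> 1 / (n\<^sup>2 * n)"
      using n f power_le_one[of f 2] by (intro frac_le mult_left_mono) auto
    moreover have "n\<^sup>2 * n = n ^ 3" by (simp add: power_numeral_reduce)
    ultimately show ?thesis by (simp only: abs_of_nonneg)
  qed
  have i2: "\<bar>1 / z\<^sup>2 - 1 / n\<^sup>2\<bar> \<le> 2 / n ^ 3"
  proof -
    have "1 / z\<^sup>2 - 1 / n\<^sup>2 = - (f * (2 * n + f) / (n\<^sup>2 * (n + f)\<^sup>2))"
      using n f unfolding z by (simp add: divide_simps) algebra
    also have "\<bar>\<dots>\<bar> = f * (2 * n + f) / (n\<^sup>2 * (n + f)\<^sup>2)" using n f by simp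
    also have "\<dots> \<le> 1 * (2 * (n + f)) / (n\<^sup>2 * (n * (n + f)))"
      using n f by (intro frac_le mult_mono) (auto simp: power2_eq_square)
    also have "\<dots> = (2 * (n + f)) / (n ^ 3 * (n + f))" by (simp add: power_numeral_reduce mult.assoc)
    also have "\<dots> = 2 / n ^ 3" using n f by (intro nonzero_mult_divide_mult_cancel_right) auto
    finally show ?thesis .
  qed
  have h: "\<bar>harm N - ln n - 1 / (2 * n) + 1 / (12 * n\<^sup>2) - euler_mascheroni\<bar> \<le> 1 / n ^ 3"
    using harm_expansion[OF assms(3)] by (simp add: n_def)
  have j1: "\<bar>(1/2 - f) * (1 / z - (1 / n - f / n\<^sup>2))\<bar> \<le> 1/2 * (1 / n ^ 3)"
  proof -
    have "\<bar>1/2 - f\<bar> \<le> 1/2" using f by linarith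
    then show ?thesis unfolding abs_mult using i1 by (intro mult_mono) auto
  qed
  have j2: "\<bar>bern2 z / 2 * (1 / z\<^sup>2 - 1 / n\<^sup>2)\<bar> \<le> 1/12 * (2 / n ^ 3)"
    unfolding abs_mult using i2 abs_bern2_le[of z] by (intro mult_mono) auto
  have b: "bern2 z = f\<^sup>2 - f + 1/6" by (simp add: bern2_def f_def)
  have eq: "ln n + f / n - f\<^sup>2 / (2 * n\<^sup>2) + (1/2 - f) * (1 / n - f / n\<^sup>2) - bern2 z / 2 * (1 / n\<^sup>2)
      = ln n + 1 / (2 * n) - 1 / (12 * n\<^sup>2)"
    unfolding b using n by (simp add: divide_simps) algebra
  have "harm N - (ln z + euler_mascheroni + (1/2 - f) / z - bern2 z / (2 * z\<^sup>2))
      = (harm N - ln n - 1 / (2 * n) + 1 / (12 * n\<^sup>2) - euler_mascheroni)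
        - (ln z - (ln n + f / n - f\<^sup>2 / (2 * n\<^sup>2)))
        - (1/2 - f) * (1 / z - (1 / n - f / n\<^sup>2)) + bern2 z / 2 * (1 / z\<^sup>2 - 1 / n\<^sup>2)"
  proof -
    have "(1/2 - f) / z = (1/2 - f) * (1 / z - (1 / n - f / n\<^sup>2)) + (1/2 - f) * (1 / n - f / n\<^sup>2)"
      by (subst distrib_left[symmetric]) simp
    moreover have "bern2 z / (2 * z\<^sup>2) = bern2 z / 2 * (1 / z\<^sup>2 - 1 / n\<^sup>2) + bern2 z / 2 * (1 / n\<^sup>2)"
      by (subst distrib_left[symmetric]) simp
    ultimately show ?thesis using eq by linarith
  qed
  then have "\<bar>harm N - (ln z + euler_mascheroni + (1/2 - f) / z - bern2 z / (2 * z\<^sup>2))\<bar>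
      \<le> 1 / n ^ 3 + 1 / (3 * n ^ 3) + 1/2 * (1 / n ^ 3) + 1/12 * (2 / n ^ 3)"
    using h l j1 j2 by linarith
  also have "\<dots> = 2 / n ^ 3" using n by (simp add: field_simps)
  finally show ?thesis by (simp add: f_def n_def)
qed

section \<open>The hyperbola method\<close>

text \<open>The increments 2m + 1 of the weights add up to A^2, as much as the boundary term. After
  division by 2x the weighted sum costs no more than \<open>U\<close>, because A^2 \<le> x.\<close>

lemma sum_square_weights_le:
  fixes b :: "nat \<Rightarrow> real"
  assumes U: "\<And>M. 0 < M \<Longrightarrow> M \<le> A \<Longrightarrow> \<bar>\<Sum>m=1..M. b m\<bar> \<le> U" and "U \<ge> 0"
  shows "\<bar>\<Sum>m=1..A. real m ^ 2 * b m\<bar> \<le> 2 * real A ^ 2 * U"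
proof -
  define T where "T M = (\<Sum>m=1..M. b m)" for M
  have T: "\<bar>T M\<bar> \<le> U" if "M \<le> A" for M
    using U[of M] that \<open>U \<ge> 0\<close> by (cases "M = 0") (auto simp: T_def)
  have abel: "(\<Sum>m=1..M. real m ^ 2 * b m) = real M ^ 2 * T M - (\<Sum>m<M. (2 * real m + 1) * T m)" for M
    by (induction M) (auto simp: T_def power2_eq_square algebra_simps)
  have "\<bar>\<Sum>m<A. (2 * real m + 1) * T m\<bar> \<le> (\<Sum>m<A. (2 * real m + 1) * U)"
    by (intro order_trans[OF sum_abs] sum_mono) (auto simp: abs_mult intro!: mult_left_mono T)
  also have "\<dots> = real A ^ 2 * U"
    by (induction A) (auto simp: power2_eq_square algebra_simps)
  finally have "\<bar>\<Sum>m<A. (2 * real m + 1) * T m\<bar> \<le> real A ^ 2 * U" .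
  moreover have "\<bar>real A ^ 2 * T A\<bar> \<le> real A ^ 2 * U"
    unfolding abs_mult using T[of A] by (intro mult_mono) auto
  ultimately show ?thesis unfolding abel by linarith
qed

lemma sum_of_nat_Icc: "(\<Sum>m=1..N. real m) = real N * (real N + 1) / 2"
  by (induction N) (auto simp: field_simps)

text \<open>The summand y - m is nearly zero at the cut-off, so the fractional part of y enters only
  through \<open>bern2\<close>.\<close>

lemma sum_diff_floor:
  fixes y :: real
  assumes "y \<ge> 0"
  shows "(\<Sum>m=1..nat \<lfloor>y\<rfloor>. y - real m) = (y\<^sup>2 - y + 1/6 - bern2 y) / 2"
proof -
  define N where "N = nat \<lfloor>y\<rfloor>"
  have N: "real N = y - frac y" using assms by (simp add: N_def frac_def)
  have "(\<Sum>m=1..N. y - real m) = real N * y - real N * (real N + 1) / 2"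
    unfolding sum_subtractf sum_of_nat_Icc by simp
  also have "\<dots> = (y\<^sup>2 - y + 1/6 - bern2 y) / 2"
    unfolding N bern2_def by (simp add: power2_eq_square field_simps)
  finally show ?thesis by (simp add: N_def)
qed

lemma le_nat_floor_divide_iff:
  fixes x :: real
  assumes "x \<ge> 0" "d > 0"
  shows "m \<le> nat \<lfloor>x / real d\<rfloor> \<longleftrightarrow> real d * real m \<le> x"
proof -
  have "m \<le> nat \<lfloor>x / real d\<rfloor> \<longleftrightarrow> real m \<le> x / real d"
    using assms by (simp add: le_nat_iff le_floor_iff)
  then show ?thesis using assms by (simp add: field_simps)
qed

text \<open>Writing n = dm and \<sigma>(n) as the sum of the m, the summand m(x/n - 1) becomes x/d -
  m. Pairs with d > A have m \<le> A, since otherwise dm \<ge> (A+1)^2 > x.\<close>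

lemma sigma_sum_hyperbola:
  fixes x :: real
  assumes "x \<ge> 0" and A: "real A ^ 2 \<le> x" "x < (real A + 1) ^ 2"
  shows "(\<Sum>n | 1 \<le> n \<and> real n \<le> x. real (sigma n) * (x / real n - 1))
    = (\<Sum>d=1..A. \<Sum>m=1..nat \<lfloor>x / real d\<rfloor>. x / real d - real m)
      + (\<Sum>m=1..A. \<Sum>d=A+1..nat \<lfloor>x / real m\<rfloor>. x / real d - real m)"
proof -
  define S where "S = {n. 1 \<le> n \<and> real n \<le> x}"
  define P1 where "P1 = Sigma {1..A} (\<lambda>d. {1..nat \<lfloor>x / real d\<rfloor>})"
  define Q where "Q = Sigma {1..A} (\<lambda>m. {A+1..nat \<lfloor>x / real m\<rfloor>})"
  define P2 where "P2 = (\<lambda>(m, d). (d, m)) ` Q"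
  define g where "g = (\<lambda>(d, m). x / real d - real m)"
  have fin: "finite P1" "finite P2" "finite Q" by (auto simp: P1_def P2_def Q_def)
  have "S \<subseteq> {..nat \<lfloor>x\<rfloor>}" using assms(1) by (auto simp: S_def le_nat_iff le_floor_iff)
  then have finS: "finite S" by (rule finite_subset) simp
  have P1: "(d, m) \<in> P1 \<longleftrightarrow> 1 \<le> d \<and> d \<le> A \<and> 1 \<le> m \<and> real (d * m) \<le> x" for d m
    using le_nat_floor_divide_iff[OF assms(1), of d m] by (auto simp: P1_def)
  have Qi: "(m, d) \<in> Q \<longleftrightarrow> 1 \<le> m \<and> m \<le> A \<and> A < d \<and> real (d * m) \<le> x" for d m
    using le_nat_floor_divide_iff[OF assms(1), of m d] by (auto simp: Q_def mult.commute)
  have P2: "(d, m) \<in> P2 \<longleftrightarrow> 1 \<le> m \<and> A < d \<and> real (d * m) \<le> x" for d m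
  proof -
    have "m \<le> A" if "A < d" "real (d * m) \<le> x"
    proof (rule ccontr)
      assume "\<not> m \<le> A"
      then have "(A + 1) * (A + 1) \<le> d * m" using that by (intro mult_mono) auto
      then have "real ((A + 1) * (A + 1)) \<le> real (d * m)" by (simp only: of_nat_le_iff)
      then show False using that A(2) by (simp add: power2_eq_square algebra_simps)
    qed
    moreover have "(d, m) \<in> P2 \<longleftrightarrow> (m, d) \<in> Q" unfolding P2_def by force
    ultimately show ?thesis using Qi by blast
  qed
  have un: "(d, m) \<in> P1 \<union> P2 \<longleftrightarrow> 1 \<le> d \<and> 1 \<le> m \<and> real (d * m) \<le> x" for d m
    using P1 P2 by auto
  have "(\<Sum>n\<in>S. real (sigma n) * (x / real n - 1)) = (\<Sum>n\<in>S. \<Sum>m | m dvd n. real m * (x / real n - 1))"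
    by (simp add: sigma_def sum_distrib_right)
  also have "\<dots> = (\<Sum>(n, m)\<in>Sigma S (\<lambda>n. {m. m dvd n}). real m * (x / real n - 1))"
    using finS by (intro sum.Sigma) (auto simp: S_def)
  also have "\<dots> = sum g (P1 \<union> P2)"
  proof (rule sum.reindex_bij_witness[where i = "\<lambda>(d, m). (d * m, m)" and j = "\<lambda>(n, m). (n div m, m)"])
    fix p assume "p \<in> Sigma S (\<lambda>n. {m. m dvd n})"
    then obtain d m where p: "p = (d * m, m)" and dm: "1 \<le> d * m" "real (d * m) \<le> x"
      by (auto simp: S_def elim!: dvdE simp: mult.commute)
    then have "m > 0" "d > 0" by (auto intro: Nat.gr0I)
    then show "(case case p of (n, m) \<Rightarrow> (n div m, m) of (d, m) \<Rightarrow> (d * m, m)) = p"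
      "(case p of (n, m) \<Rightarrow> (n div m, m)) \<in> P1 \<union> P2"
      "g (case p of (n, m) \<Rightarrow> (n div m, m)) = (case p of (n, m) \<Rightarrow> real m * (x / real n - 1))"
      using dm un[of d m] by (auto simp: p g_def field_simps)
  next
    fix p assume "p \<in> P1 \<union> P2"
    moreover obtain d m where p: "p = (d, m)" by (cases p)
    ultimately have "1 \<le> d" "1 \<le> m" "real (d * m) \<le> x" using un by auto
    then show "(case case p of (d, m) \<Rightarrow> (d * m, m) of (n, m) \<Rightarrow> (n div m, m)) = p"
      "(case p of (d, m) \<Rightarrow> (d * m, m)) \<in> Sigma S (\<lambda>n. {m. m dvd n})"
      by (auto simp: p S_def)
  qed
  also have "\<dots> = sum g P1 + sum g P2"
    using fin P1 P2 by (intro sum.union_disjoint) force+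
  also have "sum g P1 = (\<Sum>d=1..A. \<Sum>m=1..nat \<lfloor>x / real d\<rfloor>. x / real d - real m)"
    unfolding P1_def g_def by (subst sum.Sigma) auto
  also have "sum g P2 = (\<Sum>(m, d)\<in>Q. x / real d - real m)"
    unfolding P2_def by (subst sum.reindex) (auto simp: inj_on_def g_def intro!: sum.cong)
  also have "\<dots> = (\<Sum>m=1..A. \<Sum>d=A+1..nat \<lfloor>x / real m\<rfloor>. x / real d - real m)"
    unfolding Q_def by (subst sum.Sigma) auto
  finally show ?thesis by (simp only: S_def)
qed

lemma hyperbola_tail_expansion:
  fixes x :: real
  assumes m: "1 \<le> m" "m \<le> A" and A: "real A ^ 2 \<le> x"
  shows "\<bar>(\<Sum>d=A+1..nat \<lfloor>x / real m\<rfloor>. x / real d - real m)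
      - (x * (ln x - ln (real m)) + (euler_mascheroni - 1) * x + real m / 2
          - real m ^ 2 * bern2 (x / real m) / (2 * x) - x * harm A + real m * real A)\<bar> \<le> 2 * x / real A ^ 3"
proof -
  define z where "z = x / real m"
  define N where "N = nat \<lfloor>z\<rfloor>"
  have A0: "real A > 0" using m by simp
  have x: "x > 0" using A A0 by (meson less_le_trans zero_less_power)
  have z0: "z > 0" using x m by (simp add: z_def)
  have "real m * real A \<le> real A * real A" using m by (intro mult_right_mono) auto
  then have "real m * real A \<le> x" using A by (simp add: power2_eq_square)
  then have AN: "A \<le> N" unfolding N_def z_def using le_nat_floor_divide_iff[of x m A] x m by simp
  have N: "real N \<le> z" "z < real N + 1" "N > 0" using z0 AN A0 unfolding N_def by linarith+
  have frac: "real N = z - frac z" using z0 by (simp add: N_def frac_def)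
  define e where "e = harm N - (ln z + euler_mascheroni + (1/2 - frac z) / z - bern2 z / (2 * z\<^sup>2))"
  have e: "\<bar>e\<bar> \<le> 2 / real N ^ 3" unfolding e_def by (rule harm_floor_expansion[OF N])
  have harm: "harm N - harm A = (\<Sum>d=A+1..N. 1 / real d)"
  proof -
    have "{1..N} = {1..A} \<union> {A+1..N}" "{1..A} \<inter> {A+1..N} = {}" using AN by auto
    then have "harm N = harm A + (\<Sum>d=A+1..N. inverse (real d))"
      unfolding harm_def by (simp add: sum.union_disjoint)
    then show ?thesis by (simp add: inverse_eq_divide)
  qed
  have "(\<Sum>d=A+1..N. x / real d - real m) = x * (\<Sum>d=A+1..N. 1 / real d) - real m * real (N - A)"
    by (simp add: sum_subtractf sum_distrib_left)
  also have "\<dots> = x * (harm N - harm A) - real m * (real N - real A)"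
    using AN by (simp add: harm of_nat_diff)
  also have "\<dots> = x * (ln z + euler_mascheroni + (1/2 - frac z) / z - bern2 z / (2 * z\<^sup>2)) + x * e - x * harm A
      - real m * (z - frac z) + real m * real A"
    unfolding e_def frac[symmetric] by (simp add: algebra_simps)
  \<comment> \<open>The sawtooth cancels here: -m{z} from the harmonic sum meets +m{z} from -m(z -
    {z}), and m/2 and the \<open>bern2\<close> term remain.\<close>
  also have "x * (ln z + euler_mascheroni + (1/2 - frac z) / z - bern2 z / (2 * z\<^sup>2))
      = x * ln z + x * euler_mascheroni + real m * (1/2 - frac z) - real m ^ 2 * bern2 z / (2 * x)"
  proof -
    have xz: "x = real m * z" using m by (simp add: z_def)
    have "x * ((1/2 - frac z) / z) = real m * (1/2 - frac z)" using z0 unfolding xz by simp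
    moreover have "x * (bern2 z / (2 * z\<^sup>2)) = real m ^ 2 * bern2 z / (2 * x)"
      using z0 m unfolding xz by (simp add: divide_simps power2_eq_square)
    ultimately show ?thesis by (simp only: distrib_left right_diff_distrib)
  qed
  also have "ln z = ln x - ln (real m)" using x m by (simp add: z_def ln_div)
  also have "real m * (z - frac z) = x - real m * frac z" using m by (simp add: z_def right_diff_distrib)
  finally have "(\<Sum>d=A+1..N. x / real d - real m)
      - (x * (ln x - ln (real m)) + (euler_mascheroni - 1) * x + real m / 2
          - real m ^ 2 * bern2 z / (2 * x) - x * harm A + real m * real A) = x * e"
    by (simp add: algebra_simps)
  moreover have "\<bar>x * e\<bar> \<le> 2 * x / real A ^ 3"
  proof -
    have "real A ^ 3 \<le> real N ^ 3" using AN by (intro power_mono) auto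
    then have "2 / real N ^ 3 \<le> 2 / real A ^ 3" using A0 N(3) by (intro divide_left_mono) auto
    then have "\<bar>e\<bar> \<le> 2 / real A ^ 3" using e by linarith
    then have "\<bar>x * e\<bar> \<le> x * (2 / real A ^ 3)" unfolding abs_mult using x by (intro mult_mono) auto
    then show ?thesis by (simp add: mult.commute)
  qed
  ultimately show ?thesis by (simp add: N_def z_def)
qed

text \<open>Everything non-oscillating that is left beside the main term, with a = A. As a
  polynomial in a its coefficients \<open>g3\<close>, \<open>g2\<close>, \<open>g1\<close> vanish to
  orders 3, 2, 1 in \<eta>, so a\<eta> \<le> 3 bounds the terms by 27, 9 and 3; the constant term
  adds at most 1.\<close>

lemma hyperbola_remainder_le:
  fixes a x \<eta> :: real
  assumes a: "a \<ge> 25" and \<eta>: "0 \<le> \<eta>" "a * \<eta> \<le> 3" and x: "x = a\<^sup>2 * (1 + \<eta>)"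
  shows "\<bar>- x\<^sup>2 / (2 * a) + x\<^sup>2 / (4 * a\<^sup>2) - x\<^sup>2 / (12 * a ^ 3) - x / (4 * a) + x / (24 * a\<^sup>2) + a / 12
    + (x * a + x / 2) * ln (1 + \<eta>) + a\<^sup>2 / 4 + a / 4 + a ^ 3 / 2 + a\<^sup>2 / 2 - x\<bar> \<le> 40" (is "\<bar>?R\<bar> \<le> _")
proof -
  define l where "l = (1 + \<eta>) * ln (1 + \<eta>)"
  have "25 * \<eta> \<le> a * \<eta>" using a \<eta>(1) by (intro mult_right_mono) auto
  then have \<eta>1: "\<eta> \<le> 3/25" using \<eta>(2) by linarith
  have "l \<le> (1 + \<eta>) * (\<eta> - \<eta>\<^sup>2 / 2 + \<eta> ^ 3 / 3)"
    unfolding l_def using ln_one_plus_cubic[OF \<eta>(1)] \<eta>(1) by (intro mult_left_mono) auto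
  also have "\<dots> = \<eta> + \<eta>\<^sup>2 / 2 - \<eta> ^ 3 / 6 + \<eta> ^ 4 / 3" by (simp add: field_simps power_numeral_reduce)
  finally have lu: "l \<le> \<eta> + \<eta>\<^sup>2 / 2 - \<eta> ^ 3 / 6 + \<eta> ^ 4 / 3" .
  have "(1 + \<eta>) * (\<eta> - \<eta>\<^sup>2 / 2 + \<eta> ^ 3 / 3 - \<eta> ^ 4 / 4) \<le> l"
    unfolding l_def using ln_one_plus_cubic[OF \<eta>(1)] \<eta>(1) by (intro mult_left_mono) auto
  moreover have "(1 + \<eta>) * (\<eta> - \<eta>\<^sup>2 / 2 + \<eta> ^ 3 / 3 - \<eta> ^ 4 / 4) = \<eta> + \<eta>\<^sup>2 / 2 - \<eta> ^ 3 / 6 + \<eta> ^ 4 / 12 - \<eta> ^ 5 / 4"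
    by (simp add: field_simps power_numeral_reduce)
  ultimately have ll: "\<eta> + \<eta>\<^sup>2 / 2 - \<eta> ^ 3 / 6 + \<eta> ^ 4 / 12 - \<eta> ^ 5 / 4 \<le> l" by simp
  have p: "0 \<le> \<eta> ^ 3" "0 \<le> \<eta> ^ 4" "0 \<le> \<eta> ^ 5" "\<eta> ^ 4 \<le> \<eta> ^ 3" "\<eta> ^ 5 \<le> \<eta> ^ 3" "\<eta> ^ 3 \<le> \<eta> ^ 2" "\<eta> ^ 2 \<le> \<eta>"
    using \<eta>(1) \<eta>1 power_decreasing[of 1 2 \<eta>] by (auto intro!: power_decreasing)
  define w3 w4 w5 where w: "w3 = \<eta> ^ 3" "w4 = \<eta> ^ 4" "w5 = \<eta> ^ 5"
  note p = p[folded w] and lu = lu[folded w] and ll = ll[folded w]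
  define g3 where "g3 = l - \<eta> - \<eta>\<^sup>2 / 2"
  define g2 where "g2 = l / 2 + \<eta>\<^sup>2 / 4 - \<eta> / 2"
  define g1 where "g1 = - (5 * \<eta> / 12) - \<eta>\<^sup>2 / 12"
  have sq: "(1 + \<eta>)\<^sup>2 = 1 + 2 * \<eta> + \<eta>\<^sup>2" by (simp add: power2_eq_square algebra_simps)
  have "g3 \<le> \<eta> ^ 3" unfolding g3_def w[symmetric] using lu p by linarith
  moreover have "- g3 \<le> \<eta> ^ 3" unfolding g3_def w[symmetric] using ll p by linarith
  ultimately have "\<bar>g3\<bar> \<le> \<eta> ^ 3" by linarith
  then have "\<bar>a ^ 3 * g3\<bar> \<le> a ^ 3 * \<eta> ^ 3" unfolding abs_mult using a by (intro mult_mono) auto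
  also have "\<dots> = (a * \<eta>) ^ 3" by (simp add: power_mult_distrib)
  also have "\<dots> \<le> 3 ^ 3" using a \<eta> by (intro power_mono) auto
  finally have t3: "\<bar>a ^ 3 * g3\<bar> \<le> 27" by simp
  have "g2 \<le> \<eta> ^ 2" unfolding g2_def w[symmetric] using lu p by linarith
  moreover have "- g2 \<le> \<eta> ^ 2" unfolding g2_def w[symmetric] using ll p by linarith
  ultimately have "\<bar>g2\<bar> \<le> \<eta> ^ 2" by linarith
  then have "\<bar>a ^ 2 * g2\<bar> \<le> a ^ 2 * \<eta> ^ 2" unfolding abs_mult using a by (intro mult_mono) auto
  also have "\<dots> = (a * \<eta>) ^ 2" by (simp add: power_mult_distrib)
  also have "\<dots> \<le> 3 ^ 2" using a \<eta> by (intro power_mono) auto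
  finally have t2: "\<bar>a ^ 2 * g2\<bar> \<le> 9" by simp
  have "\<bar>g1\<bar> \<le> \<eta>" unfolding g1_def using p \<eta>(1) zero_le_power2[of \<eta>] by linarith
  then have "\<bar>a * g1\<bar> \<le> a * \<eta>" unfolding abs_mult using a by (intro mult_mono) auto
  then have t1: "\<bar>a * g1\<bar> \<le> 3" using \<eta>(2) by linarith
  have eqR: "?R = a ^ 3 * g3 + a\<^sup>2 * g2 + a * g1 + (1 + \<eta>) / 24"
  proof -
    have a0: "a \<noteq> 0" using a by simp
    have E: "- x\<^sup>2 / (2 * a) = - (a ^ 3 * (1 + \<eta>)\<^sup>2 / 2)" "x\<^sup>2 / (4 * a\<^sup>2) = a\<^sup>2 * (1 + \<eta>)\<^sup>2 / 4" "x\<^sup>2 / (12 * a ^ 3) = a * (1 + \<eta>)\<^sup>2 / 12"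
      "x / (4 * a) = a * (1 + \<eta>) / 4" "x / (24 * a\<^sup>2) = (1 + \<eta>) / 24" "(x * a + x / 2) * ln (1 + \<eta>) = a ^ 3 * l + a\<^sup>2 * l / 2"
      using a0 unfolding x l_def by (simp_all add: power_mult_distrib power_numeral_reduce field_simps)
    show ?thesis unfolding E unfolding g3_def g2_def g1_def sq x by (simp add: field_simps)
  qed
  have "0 \<le> (1 + \<eta>) / 24" "(1 + \<eta>) / 24 \<le> 1" using \<eta>1 \<eta>(1) by auto
  then show ?thesis unfolding eqR using t3 t2 t1 by linarith
qed

lemma sigma_sum_expansion:
  fixes x :: real
  assumes A: "A \<ge> 25" "real A ^ 2 \<le> x" "x < (real A + 1) ^ 2"
  shows "\<bar>(\<Sum>n | 1 \<le> n \<and> real n \<le> x. real (sigma n) * (x / real n - 1))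
     - (x\<^sup>2 / 2 * (pi\<^sup>2 / 6) - x / 2 * ln x - x / 2 * (ln (2 * pi) + euler_mascheroni - 1)
        - (\<Sum>m=1..A. bern2 (x / real m)) / 2 - (\<Sum>m=1..A. real m ^ 2 * bern2 (x / real m)) / (2 * x))\<bar> \<le> 50"
proof -
  define a where "a = real A"
  have a: "a \<ge> 25" "a > 0" using A(1) by (auto simp: a_def)
  have x: "x > 0" using A(2) a(2) unfolding a_def by (meson less_le_trans zero_less_power)
  define \<eta> where "\<eta> = x / a\<^sup>2 - 1"
  have x\<eta>: "x = a\<^sup>2 * (1 + \<eta>)" using a by (simp add: \<eta>_def)
  have \<eta>0: "\<eta> \<ge> 0" using A(2) a by (simp add: \<eta>_def a_def)
  have a\<eta>: "a * \<eta> \<le> 3"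
  proof -
    have "a * (a * \<eta>) \<le> 2 * a + 1" using A(3) a unfolding \<eta>_def a_def[symmetric]
      by (simp add: power2_eq_square algebra_simps)
    also have "\<dots> \<le> a * 3" using a by simp
    finally show ?thesis using a by simp
  qed
  have "25 * \<eta> \<le> a * \<eta>" using a \<eta>0 by (intro mult_right_mono) auto
  then have \<eta>1: "\<eta> \<le> 3/25" using a\<eta> by linarith
  define Z where "Z = (\<Sum>k=1..A. 1 / real k ^ 2)"
  define F where "F = ln (fact A :: real)"
  define h where "h = (harm A :: real)"
  define T where "T = (\<Sum>m=1..A. bern2 (x / real m))"
  define W where "W = (\<Sum>m=1..A. real m ^ 2 * bern2 (x / real m))"
  define e1 where "e1 = Z + 1 / a - 1 / (2 * a ^ 2) + 1 / (6 * a ^ 3) - pi\<^sup>2 / 6"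
  define e2 where "e2 = h - ln a - 1 / (2 * a) + 1 / (12 * a ^ 2) - euler_mascheroni"
  define e3 where "e3 = F - (a + 1/2) * ln a + a - 1 / (12 * a) - ln (2 * pi) / 2"
  have e1: "\<bar>e1\<bar> \<le> 1 / a ^ 4" unfolding e1_def a_def Z_def using inverse_squares_expansion[of A] A(1) by simp
  have e2: "\<bar>e2\<bar> \<le> 1 / a ^ 3" unfolding e2_def a_def h_def using harm_expansion[of A] A(1) by simp
  have e3: "\<bar>e3\<bar> \<le> 1 / a ^ 2" unfolding e3_def a_def F_def using ln_fact_expansion[of A] A(1) by simp
  define S1 where "S1 = (\<Sum>d=1..A. \<Sum>m=1..nat \<lfloor>x / real d\<rfloor>. x / real d - real m)"
  define S2 where "S2 = (\<Sum>m=1..A. \<Sum>d=A+1..nat \<lfloor>x / real m\<rfloor>. x / real d - real m)"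
  define M where "M = x * a * ln x - x * F + (euler_mascheroni - 1) * x * a + a * (a + 1) / 4 - W / (2 * x) - x * a * h + a\<^sup>2 * (a + 1) / 2"
  have S1: "S1 = x\<^sup>2 / 2 * Z - x / 2 * h + a / 12 - T / 2"
  proof -
    have "S1 = (\<Sum>d=1..A. ((x / real d)\<^sup>2 - x / real d + 1/6 - bern2 (x / real d)) / 2)"
      unfolding S1_def using x by (intro sum.cong sum_diff_floor) auto
    also have "\<dots> = (x\<^sup>2 * Z - x * h + a / 6 - T) / 2"
      unfolding Z_def h_def T_def a_def harm_def
      by (simp add: sum.distrib sum_subtractf sum_distrib_left power_divide inverse_eq_divide flip: sum_divide_distrib)
    finally show ?thesis by (simp add: field_simps)
  qed
  have S2: "\<bar>S2 - M\<bar> \<le> 2 * x / a ^ 2"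
  proof -
    define q where "q m = x * (ln x - ln (real m)) + (euler_mascheroni - 1) * x + real m / 2
          - real m ^ 2 * bern2 (x / real m) / (2 * x) - x * h + real m * a" for m
    have F: "F = (\<Sum>m=1..A. ln (real m))"
      unfolding F_def fact_prod of_nat_prod by (subst ln_prod) auto
    have "(\<Sum>m=1..A. q m) = (\<Sum>m=1..A. x * ln x) - x * (\<Sum>m=1..A. ln (real m)) + (\<Sum>m=1..A. (euler_mascheroni - 1) * x)
        + (\<Sum>m=1..A. real m) / 2 - W / (2 * x) - (\<Sum>m=1..A. x * h) + (\<Sum>m=1..A. real m) * a"
      unfolding q_def W_def right_diff_distrib
      by (simp only: sum.distrib sum_subtractf sum_distrib_left sum_distrib_right sum_divide_distrib)
    also have "\<dots> = M"
      unfolding M_def sum_of_nat_Icc F[symmetric] a_def[symmetric] by (simp add: a_def[symmetric] power2_eq_square field_simps)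
    finally have "S2 - M = (\<Sum>m=1..A. (\<Sum>d=A+1..nat \<lfloor>x / real m\<rfloor>. x / real d - real m) - q m)"
      by (simp add: S2_def sum_subtractf)
    also have "\<bar>\<dots>\<bar> \<le> (\<Sum>m=1..A. 2 * x / a ^ 3)"
    proof (intro order_trans[OF sum_abs] sum_mono)
      fix m assume "m \<in> {1..A}"
      then show "\<bar>(\<Sum>d=A+1..nat \<lfloor>x / real m\<rfloor>. x / real d - real m) - q m\<bar> \<le> 2 * x / a ^ 3"
        unfolding q_def a_def h_def by (intro hyperbola_tail_expansion A(2)) auto
    qed
    also have "\<dots> = 2 * x / a ^ 2" using a by (simp add: a_def[symmetric] power_numeral_reduce)
    finally show ?thesis .
  qed
  have lx: "ln x = 2 * ln a + ln (1 + \<eta>)"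
    unfolding x\<eta> using a \<eta>0 by (simp add: ln_mult ln_realpow)
  define R where "R = - x\<^sup>2 / (2 * a) + x\<^sup>2 / (4 * a\<^sup>2) - x\<^sup>2 / (12 * a ^ 3) - x / (4 * a) + x / (24 * a\<^sup>2) + a / 12
    + (x * a + x / 2) * ln (1 + \<eta>) + a\<^sup>2 / 4 + a / 4 + a ^ 3 / 2 + a\<^sup>2 / 2 - x"
  have R: "\<bar>R\<bar> \<le> 40" unfolding R_def by (rule hyperbola_remainder_le[OF a(1) \<eta>0 a\<eta> x\<eta>])
  have Z: "Z = pi\<^sup>2 / 6 - 1 / a + 1 / (2 * a ^ 2) - 1 / (6 * a ^ 3) + e1" by (simp add: e1_def)
  have h: "h = ln a + euler_mascheroni + 1 / (2 * a) - 1 / (12 * a ^ 2) + e2" by (simp add: e2_def)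
  have F: "F = (a + 1/2) * ln a - a + ln (2 * pi) / 2 + 1 / (12 * a) + e3" by (simp add: e3_def)
  \<comment> \<open>An exact identity. All multiples of log a combine to -x log a, which is -(x/2)
    log x + (x/2) log(1 + \<eta>); the last part sits in \<open>R\<close>.\<close>
  have main: "S1 + M = (x\<^sup>2 / 2 * (pi\<^sup>2 / 6) - x / 2 * ln x - x / 2 * (ln (2 * pi) + euler_mascheroni - 1) - T / 2 - W / (2 * x))
      + R + x\<^sup>2 / 2 * e1 - x / 2 * e2 - x * e3 - x * a * e2"
    unfolding S1 M_def R_def Z h F lx using a x
    by (simp add: field_simps power_numeral_reduce)
  have xa: "x / a\<^sup>2 \<le> 28/25" using \<eta>1 by (simp add: \<eta>_def)
  have b1: "\<bar>x\<^sup>2 / 2 * e1\<bar> \<le> 1"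
  proof -
    have "\<bar>x\<^sup>2 / 2 * e1\<bar> \<le> x\<^sup>2 / 2 * (1 / a ^ 4)" unfolding abs_mult using e1 by (intro mult_mono) auto
    also have "\<dots> = (x / a\<^sup>2)\<^sup>2 / 2" by (simp add: power_divide flip: power_mult)
    also have "(x / a\<^sup>2)\<^sup>2 \<le> (28/25)\<^sup>2" using xa x by (intro power_mono) auto
    finally show ?thesis by (simp add: power2_eq_square)
  qed
  have b2: "\<bar>x * a * e2\<bar> \<le> 2"
  proof -
    have "\<bar>x * a * e2\<bar> \<le> x * a * (1 / a ^ 3)" unfolding abs_mult using e2 x a by (intro mult_mono) auto
    also have "\<dots> = x / a\<^sup>2" using a by (simp add: power_numeral_reduce)
    finally show ?thesis using xa by linarith
  qed
  have b3: "\<bar>x * e3\<bar> \<le> 2"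
  proof -
    have "\<bar>x * e3\<bar> \<le> x * (1 / a ^ 2)" unfolding abs_mult using e3 x a by (intro mult_mono) auto
    then have "\<bar>x * e3\<bar> \<le> x / a\<^sup>2" by simp
    then show ?thesis using xa by linarith
  qed
  have b4: "\<bar>x / 2 * e2\<bar> \<le> 2"
  proof -
    have "x / 2 \<le> x * a" using x a by (simp add: field_simps)
    then have "\<bar>x / 2 * e2\<bar> \<le> \<bar>x * a * e2\<bar>" unfolding abs_mult using x a by (intro mult_right_mono) auto
    then show ?thesis using b2 by linarith
  qed
  have "2 * x / a ^ 2 = 2 * (x / a\<^sup>2)" by simp
  then have b5: "\<bar>S2 - M\<bar> \<le> 3" using S2 xa by linarith
  have "(\<Sum>n | 1 \<le> n \<and> real n \<le> x. real (sigma n) * (x / real n - 1)) = S1 + S2"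
    unfolding S1_def S2_def using x A by (intro sigma_sum_hyperbola) auto
  \<comment> \<open>40 for \<open>R\<close>, then 1 + 2 + 2 + 2 for the expansion errors and 3 for
    \<open>S2\<close>: 50 in total.\<close>
  then show ?thesis unfolding T_def[symmetric] W_def[symmetric] using main R b1 b2 b3 b4 b5 by linarith
qed

lemma zeta_2: "zeta 2 = pi\<^sup>2 / 6"
proof -
  have "(\<lambda>n. 1 / real (Suc n) powr 2) sums (pi\<^sup>2 / 6)"
    using inverse_squares_sums by (simp add: add.commute)
  then show ?thesis unfolding zeta_def by (rule sums_unique[symmetric])
qed

theorem theorem1p1:
  fixes x :: real
  assumes "x \<ge> 650"
  shows "\<bar>(D_err x - x * d_err x) - x / 2 * (ln (2 * pi) + euler_mascheroni - 1)\<bar>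
           \<le> 16 * x powr (3 / 10) * ln x"
proof -
  define A where "A = nat \<lfloor>sqrt x\<rfloor>"
  have rA: "real A \<le> sqrt x" "sqrt x < real A + 1"
    using assms unfolding A_def by simp_all
  have A2: "real A ^ 2 \<le> x" using power_mono[OF rA(1), of 2] assms by simp
  have A3: "x < (real A + 1) ^ 2" using power_strict_mono[OF rA(2), of 2] assms by simp
  have A: "A \<ge> 25"
  proof (rule ccontr)
    assume "\<not> A \<ge> 25"
    then have "(real A + 1) ^ 2 \<le> 25 ^ 2" by (intro power_mono) auto
    then show False using A3 assms by simp
  qed
  define X where "X = x powr (3/10)"
  define L where "L = ln x"
  have L: "L \<ge> 6"
  proof -
    have "exp (6::real) = exp 1 ^ 6" by (simp flip: exp_of_nat_mult)
    also have "\<dots> \<le> (272/100) ^ 6"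
    proof (rule power_mono)
      have "exp 1 \<le> exp (ln (272/100 :: real))" using ln_272_gt_1 by (subst exp_le_cancel_iff) simp
      then show "exp 1 \<le> (272/100 :: real)" by simp
    qed simp
    also have "\<dots> \<le> (650::real)" by (simp add: power_divide)
    also have "\<dots> \<le> x" by (rule assms)
    finally show ?thesis unfolding L_def using assms by (simp add: ln_ge_iff)
  qed
  have X: "X \<ge> 6"
  proof -
    have "6 = (6 ^ 10) powr (1/10::real)" by (simp add: powr_powr flip: powr_realpow)
    also have "\<dots> \<le> (x ^ 3) powr (1/10)"
      using power_mono[OF assms, of 3] by (intro powr_mono2) auto
    also have "\<dots> = (x powr 3) powr (1/10)" using assms by (simp add: powr_numeral)
    also have "\<dots> = X" by (simp add: X_def powr_powr)
    finally show ?thesis .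
  qed
  \<comment> \<open>10 exceeds 96/pi^2, and 3/4 comes from log A \<le> L/2 together with log 2 \<ge>
    2/3.\<close>
  define U where "U = 10 * X * (1 + 3/4 * L)"
  have U0: "U \<ge> 0" using X L by (simp add: U_def)
  have U: "\<bar>\<Sum>m=1..M. bern2 (x / real m)\<bar> \<le> U" if M: "0 < M" "M \<le> A" for M
  proof -
    have "real M ^ 2 \<le> real A ^ 2" using M by (intro power_mono) auto
    then have "real M ^ 2 \<le> x" using A2 by linarith
    then have "\<bar>\<Sum>m=1..M. bern2 (x / real m)\<bar> \<le> 96 / pi\<^sup>2 * X * (1 + log 2 (real M))"
      unfolding X_def by (rule bern2_sum_le[OF M(1)])
    also have "\<dots> \<le> 10 * X * (1 + 3/4 * L)"
    proof (intro mult_mono)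
      have "3.1 ^ 2 \<le> pi ^ 2" using pi_approx(1) by (intro power_mono) auto
      then show "96 / pi\<^sup>2 \<le> 10" by (simp add: field_simps)
      have "2 * ln (real M) = ln (real M ^ 2)" using M by (simp add: ln_realpow)
      also have "\<dots> \<le> L" unfolding L_def using \<open>real M ^ 2 \<le> x\<close> M assms by (subst ln_le_cancel_iff) auto
      finally have "ln (real M) \<le> L / 2" by simp
      moreover have "L / 2 \<le> 3/4 * L * ln 2"
        using L ln2_ge_two_thirds mult_left_mono[of "2/3" "ln 2" "3/4 * L"] by simp
      ultimately show "1 + log 2 (real M) \<le> 1 + 3/4 * L" by (simp add: log_def field_simps)
      show "0 \<le> 1 + log 2 (real M)" using M by simp
    qed (use X in auto)
    finally show ?thesis by (simp add: U_def)
  qed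
  define T where "T = (\<Sum>m=1..A. bern2 (x / real m))"
  define W where "W = (\<Sum>m=1..A. real m ^ 2 * bern2 (x / real m))"
  have T: "\<bar>T\<bar> \<le> U" unfolding T_def using A by (intro U) auto
  have W: "\<bar>W / (2 * x)\<bar> \<le> U"
  proof -
    have "\<bar>W\<bar> \<le> 2 * real A ^ 2 * U" unfolding W_def by (rule sum_square_weights_le[OF U U0])
    also have "\<dots> \<le> 2 * x * U" using A2 U0 by (intro mult_right_mono) auto
    finally show ?thesis using assms by (simp add: field_simps)
  qed
  define I where "I = (\<Sum>n | 1 \<le> n \<and> real n \<le> x. real (sigma n) * (x / real n - 1))"
  have "D_err x - x * d_err x = x\<^sup>2 / 2 * (pi\<^sup>2 / 6) - x / 2 * ln x - I"
  proof -
    have "I = x * (\<Sum>n | 1 \<le> n \<and> real n \<le> x. real (sigma n) / real n) - (\<Sum>n | 1 \<le> n \<and> real n \<le> x. real (sigma n))"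
      by (simp add: I_def sum_distrib_left right_diff_distrib mult.commute flip: sum_subtractf)
    then show ?thesis unfolding D_err_def d_err_def zeta_2 by (simp add: power2_eq_square field_simps)
  qed
  moreover have "\<bar>I - (x\<^sup>2 / 2 * (pi\<^sup>2 / 6) - x / 2 * ln x - x / 2 * (ln (2 * pi) + euler_mascheroni - 1) - T / 2 - W / (2 * x))\<bar> \<le> 50"
    unfolding I_def T_def W_def by (rule sigma_sum_expansion[OF A A2 A3])
  ultimately have "\<bar>(D_err x - x * d_err x) - x / 2 * (ln (2 * pi) + euler_mascheroni - 1)\<bar> \<le> 3/2 * U + 50"
    using T W by linarith
  also have "\<dots> \<le> 16 * X * L"
  proof -
    \<comment> \<open>With X, L \<ge> 6 the terms 15X and 50 are at most 15/6 and 50/36 times XL,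
      and 45/4 + 15/6 + 50/36 < 16. The factor 3/2 before \<open>U\<close> is 1/2 from the plain sum
      plus 1 from the weighted one.\<close>
    have "6 * 6 \<le> X * L" using X L by (intro mult_mono) auto
    moreover have "X * 6 \<le> X * L" using X L by (intro mult_left_mono) auto
    moreover have "3/2 * U + 50 = 15 * X + 45/4 * (X * L) + 50" by (simp add: U_def algebra_simps)
    moreover have "16 * X * L = 16 * (X * L)" by simp
    ultimately show ?thesis by linarith
  qed
  finally show ?thesis by (simp add: X_def L_def)
qed

end
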